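(* Let $k$ be a field and let $Z$ be a $k$-space equipped with a $\mathbb{G}_m$-action. The canonical morphism $\widetilde{p}:\widetilde{Z}\to\mathbb{A}^1\times Z\times Z$ induces an isomorphism between $$\mathbb{G}_m\times_{\mathbb{A}^1}\widetilde{Z}\subset\widetilde{Z}$$ and the graph $\{(t,z_1,z_2)\in\mathbb{G}_m\times Z\times Z\mid t\cdot z_1=z_2\}$ of the action morphism $\mathbb{G}_m\times Z\to Z$.
   Context: $k$ is an arbitrary field. A $k$-space is a contravariant functor from $k$-schemes to sets which is a sheaf for the fpqc topology. $\mathbb{G}_m$ is viewed as the open subscheme $\mathbb{A}^1-\{0\}\subset\mathbb{A}^1$. Let $\mathbb{X}:=\mathbb{A}^2=\mathrm{Spec}\,k[\tau_1,\tau_2]$, viewed as a scheme over $\mathbb{A}^1$ via $(\tau_1,\tau_2)\mapsto\tau_1\tau_2$, with the $\mathbb{G}_m$-action $\lambda\cdot(\tau_1,\tau_2)=(\lambda\tau_1,\lambda^{-1}\tau_2)$. For a scheme $S$ over $\mathbb{A}^1$ set $\mathbb{X}_S:=\mathbb{X}\times_{\mathbb{A}^1}S$. $\widetilde{Z}$ is the space over $\mathbb{A}^1$ such that $\mathrm{Maps}_{\mathbb{A}^1}(S,\widetilde{Z})=\mathrm{Maps}^{\mathbb{G}_m}(\mathbb{X}_S,Z)$ (equivariant morphisms) for any scheme $S$ over $\mathbb{A}^1$. A section $\sigma:\mathbb{A}^1\to\mathbb{X}$ of $\mathbb{X}\to\mathbb{A}^1$ induces by pullback a morphism $\widetilde{Z}\to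 Z$. Let $\pi_1,\pi_2:\widetilde{Z}\to Z$ be the morphisms corresponding to the sections $t\mapsto(1,t)$ and $t\mapsto(t,1)$, respectively. The morphism $\widetilde{p}:\widetilde{Z}\to\mathbb{A}^1\times Z\times Z$ has as components the tautological projection $\widetilde{Z}\to\mathbb{A}^1$, $\pi_1$, and $\pi_2$. *)

theory Defs
  imports
    "HOL-Analysis.Abstract_Topology"
    "HOL-Algebra.Ideal"
    "HOL-Algebra.Module"
    "HOL-Algebra.Generated_Groups"
    "HOL-Algebra.Free_Abelian_Groups"
begin

section \<open>Commutative algebra\<close>

definition local_ring :: "('a, 'm) ring_scheme \<Rightarrow> bool" where
  "local_ring R \<longleftrightarrow> cring R \<and> (\<exists>!M. maximalideal M R)"

text \<open>The fraction \<open>a / f\<close> in the localization of \<open>A\<close> at the prime ideal \<open>P\<close>, as an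
  equivalence class of pairs.\<close>

definition loc_frac :: "('a, 'm) ring_scheme \<Rightarrow> 'a set \<Rightarrow> 'a \<Rightarrow> 'a \<Rightarrow> ('a \<times> 'a) set" where
  "loc_frac A P a f = {(b, g). b \<in> carrier A \<and> g \<in> carrier A - P \<and>
     (\<exists>h \<in> carrier A - P. h \<otimes>\<^bsub>A\<^esub> (g \<otimes>\<^bsub>A\<^esub> a \<ominus>\<^bsub>A\<^esub> f \<otimes>\<^bsub>A\<^esub> b) = \<zero>\<^bsub>A\<^esub>)}"

definition localization :: "('a, 'm) ring_scheme \<Rightarrow> 'a set \<Rightarrow> ('a \<times> 'a) set ring" where
  "localization A P =
    \<lparr>carrier = {loc_frac A P a f | a f. a \<in> carrier A \<and> f \<in> carrier A - P},
     monoid.mult = (\<lambda>x y. \<Union>(a, f) \<in> x. \<Union>(b, g) \<in> y. loc_frac A P (a \<otimes>\<^bsub>A\<^esub> b) (f \<otimes>\<^bsub>A\<^esub> g)),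
     monoid.one = loc_frac A P \<one>\<^bsub>A\<^esub> \<one>\<^bsub>A\<^esub>,
     ring.zero = loc_frac A P \<zero>\<^bsub>A\<^esub> \<one>\<^bsub>A\<^esub>,
     ring.add = (\<lambda>x y. \<Union>(a, f) \<in> x. \<Union>(b, g) \<in> y.
       loc_frac A P (a \<otimes>\<^bsub>A\<^esub> g \<oplus>\<^bsub>A\<^esub> b \<otimes>\<^bsub>A\<^esub> f) (f \<otimes>\<^bsub>A\<^esub> g))\<rparr>"

text \<open>The tensor product of \<open>K\<close> and \<open>M\<close> over \<open>R\<close> is the quotient of the free abelian group on
  \<open>carrier K \<times> carrier M\<close> by the following subgroup.\<close>

definition tensor_relations ::
  "('a, 'm) ring_scheme \<Rightarrow> ('a, 'b, 'n) module_scheme \<Rightarrow> ('a, 'c, 'l) module_scheme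
    \<Rightarrow> ('b \<times> 'c \<Rightarrow>\<^sub>0 int) set" where
  "tensor_relations R K M = generate (free_Abelian_group (carrier K \<times> carrier M))
    ({frag_of (x \<oplus>\<^bsub>K\<^esub> y, m) - frag_of (x, m) - frag_of (y, m) | x y m.
        x \<in> carrier K \<and> y \<in> carrier K \<and> m \<in> carrier M} \<union>
     {frag_of (x, m \<oplus>\<^bsub>M\<^esub> n) - frag_of (x, m) - frag_of (x, n) | x m n.
        x \<in> carrier K \<and> m \<in> carrier M \<and> n \<in> carrier M} \<union>
     {frag_of (a \<odot>\<^bsub>K\<^esub> x, m) - frag_of (x, a \<odot>\<^bsub>M\<^esub> m) | a x m.
        a \<in> carrier R \<and> x \<in> carrier K \<and> m \<in> carrier M})"

definition tensor_map :: "('b \<Rightarrow> 'd) \<Rightarrow> ('b \<times> 'c \<Rightarrow>\<^sub>0 int) \<Rightarrow> ('d \<times> 'c \<Rightarrow>\<^sub>0 int)" where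
  "tensor_map u = frag_extend (\<lambda>(x, m). frag_of (u x, m))"

definition linear_map ::
  "('a, 'm) ring_scheme \<Rightarrow> ('a, 'b, 'n) module_scheme \<Rightarrow> ('a, 'c, 'l) module_scheme
    \<Rightarrow> ('b \<Rightarrow> 'c) \<Rightarrow> bool" where
  "linear_map R K L u \<longleftrightarrow>
    u \<in> carrier K \<rightarrow> carrier L \<and>
    (\<forall>x \<in> carrier K. \<forall>y \<in> carrier K. u (x \<oplus>\<^bsub>K\<^esub> y) = u x \<oplus>\<^bsub>L\<^esub> u y) \<and>
    (\<forall>a \<in> carrier R. \<forall>x \<in> carrier K. u (a \<odot>\<^bsub>K\<^esub> x) = a \<odot>\<^bsub>L\<^esub> u x)"

text \<open>\<open>M\<close> is flat if tensoring with \<open>M\<close> preserves injectivity of linear maps \<open>u\<close>; injectivity of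
  the induced map of tensor products is expressed by the triviality of its kernel.
  The test modules \<open>K\<close>, \<open>L\<close> have elements of the same type as \<open>R\<close>. This is no restriction, since
  the inclusions of the ideals into \<open>R\<close> already suffice to test flatness.\<close>

definition flat_module :: "('a, 'm) ring_scheme \<Rightarrow> ('a, 'b, 'n) module_scheme \<Rightarrow> bool" where
  "flat_module R M \<longleftrightarrow> module R M \<and>
    (\<forall>(K :: ('a, 'a) module) (L :: ('a, 'a) module) u.
       module R K \<and> module R L \<and> linear_map R K L u \<and> inj_on u (carrier K) \<longrightarrow>
       (\<forall>c \<in> carrier (free_Abelian_group (carrier K \<times> carrier M)).
          tensor_map u c \<in> tensor_relations R L M \<longrightarrow> c \<in> tensor_relations R K M))"

definition restrict_scalars :: "('a \<Rightarrow> 'b) \<Rightarrow> ('b, 'm) ring_scheme \<Rightarrow> ('a, 'b) module" where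
  "restrict_scalars \<phi> S =
    \<lparr>carrier = carrier S, monoid.mult = monoid.mult S, monoid.one = \<one>\<^bsub>S\<^esub>,
     ring.zero = \<zero>\<^bsub>S\<^esub>, ring.add = ring.add S,
     smult = (\<lambda>a x. \<phi> a \<otimes>\<^bsub>S\<^esub> x)\<rparr>"

section \<open>Ringed spaces\<close>

text \<open>Sections may be given over arbitrary sets of points, but only their values on open sets
  matter. \<open>rs_res X U V\<close> is the restriction from \<open>U\<close> to \<open>V\<close>.\<close>

record ('p, 'r) ringed_space =
  rs_top :: "'p topology"
  rs_sec :: "'p set \<Rightarrow> 'r ring"
  rs_res :: "'p set \<Rightarrow> 'p set \<Rightarrow> 'r \<Rightarrow> 'r"

abbreviation rs_open :: "('p, 'r) ringed_space \<Rightarrow> 'p set \<Rightarrow> bool" where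
  "rs_open X U \<equiv> openin (rs_top X) U"

abbreviation rs_points :: "('p, 'r) ringed_space \<Rightarrow> 'p set" where
  "rs_points X \<equiv> topspace (rs_top X)"

definition ringed_space :: "('p, 'r) ringed_space \<Rightarrow> bool" where
  "ringed_space X \<longleftrightarrow>
    (\<forall>U. rs_open X U \<longrightarrow> cring (rs_sec X U)) \<and>
    (\<forall>U V. rs_open X U \<and> rs_open X V \<and> V \<subseteq> U \<longrightarrow>
       rs_res X U V \<in> ring_hom (rs_sec X U) (rs_sec X V)) \<and>
    (\<forall>U s. rs_open X U \<and> s \<in> carrier (rs_sec X U) \<longrightarrow> rs_res X U U s = s) \<and>
    (\<forall>U V W s. rs_open X U \<and> rs_open X V \<and> rs_open X W \<and> W \<subseteq> V \<and> V \<subseteq> U \<and>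
       s \<in> carrier (rs_sec X U) \<longrightarrow> rs_res X V W (rs_res X U V s) = rs_res X U W s) \<and>
    (\<forall>\<C> \<sigma>. (\<forall>V \<in> \<C>. rs_open X V \<and> \<sigma> V \<in> carrier (rs_sec X V)) \<and>
       (\<forall>V \<in> \<C>. \<forall>W \<in> \<C>. rs_res X V (V \<inter> W) (\<sigma> V) = rs_res X W (V \<inter> W) (\<sigma> W)) \<longrightarrow>
       (\<exists>!s. s \<in> carrier (rs_sec X (\<Union>\<C>)) \<and> (\<forall>V \<in> \<C>. rs_res X (\<Union>\<C>) V s = \<sigma> V)))"

definition germ :: "('p, 'r) ringed_space \<Rightarrow> 'p \<Rightarrow> 'p set \<Rightarrow> 'r \<Rightarrow> ('p set \<times> 'r) set" where
  "germ X x U s = {(V, t). rs_open X V \<and> x \<in> V \<and> t \<in> carrier (rs_sec X V) \<and>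
     (\<exists>W. rs_open X W \<and> x \<in> W \<and> W \<subseteq> U \<inter> V \<and> rs_res X U W s = rs_res X V W t)}"

definition stalk :: "('p, 'r) ringed_space \<Rightarrow> 'p \<Rightarrow> ('p set \<times> 'r) set ring" where
  "stalk X x =
    \<lparr>carrier = {germ X x U s | U s. rs_open X U \<and> x \<in> U \<and> s \<in> carrier (rs_sec X U)},
     monoid.mult = (\<lambda>a b. \<Union>(U, s) \<in> a. \<Union>(V, t) \<in> b. germ X x (U \<inter> V)
       (rs_res X U (U \<inter> V) s \<otimes>\<^bsub>rs_sec X (U \<inter> V)\<^esub> rs_res X V (U \<inter> V) t)),
     monoid.one = germ X x (rs_points X) \<one>\<^bsub>rs_sec X (rs_points X)\<^esub>,
     ring.zero = germ X x (rs_points X) \<zero>\<^bsub>rs_sec X (rs_points X)\<^esub>,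
     ring.add = (\<lambda>a b. \<Union>(U, s) \<in> a. \<Union>(V, t) \<in> b. germ X x (U \<inter> V)
       (rs_res X U (U \<inter> V) s \<oplus>\<^bsub>rs_sec X (U \<inter> V)\<^esub> rs_res X V (U \<inter> V) t))\<rparr>"

definition locally_ringed_space :: "('p, 'r) ringed_space \<Rightarrow> bool" where
  "locally_ringed_space X \<longleftrightarrow> ringed_space X \<and> (\<forall>x \<in> rs_points X. local_ring (stalk X x))"

text \<open>A morphism from \<open>X\<close> to \<open>Y\<close> is a pair of a map on points and maps from the sections of \<open>Y\<close>
  over \<open>V\<close> to the sections of \<open>X\<close> over the preimage of \<open>V\<close>. Both are \<open>undefined\<close> outside their
  domains, so that equality of morphisms is equality of pairs.\<close>

type_synonym ('p, 'r, 'q, 's) rs_mor = "('p \<Rightarrow> 'q) \<times> ('q set \<Rightarrow> 's \<Rightarrow> 'r)"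

definition rs_vimage ::
  "('p, 'r) ringed_space \<Rightarrow> ('p, 'r, 'q, 's) rs_mor \<Rightarrow> 'q set \<Rightarrow> 'p set" where
  "rs_vimage X f V = {x \<in> rs_points X. fst f x \<in> V}"

definition stalk_map ::
  "('p, 'r) ringed_space \<Rightarrow> ('p, 'r, 'q, 's) rs_mor \<Rightarrow> 'p
    \<Rightarrow> ('q set \<times> 's) set \<Rightarrow> ('p set \<times> 'r) set" where
  "stalk_map X f x a = (\<Union>(V, s) \<in> a. germ X x (rs_vimage X f V) (snd f V s))"

definition lrs_hom ::
  "('p, 'r) ringed_space \<Rightarrow> ('q, 's) ringed_space \<Rightarrow> ('p, 'r, 'q, 's) rs_mor set" where
  "lrs_hom X Y = {f.
    continuous_map (rs_top X) (rs_top Y) (fst f) \<and>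
    fst f \<in> extensional (rs_points X) \<and>
    (\<forall>V s. \<not> (rs_open Y V \<and> s \<in> carrier (rs_sec Y V)) \<longrightarrow> snd f V s = undefined) \<and>
    (\<forall>V. rs_open Y V \<longrightarrow> snd f V \<in> ring_hom (rs_sec Y V) (rs_sec X (rs_vimage X f V))) \<and>
    (\<forall>U V s. rs_open Y U \<and> rs_open Y V \<and> V \<subseteq> U \<and> s \<in> carrier (rs_sec Y U) \<longrightarrow>
       rs_res X (rs_vimage X f U) (rs_vimage X f V) (snd f U s) = snd f V (rs_res Y U V s)) \<and>
    (\<forall>x \<in> rs_points X. \<forall>a \<in> carrier (stalk Y (fst f x)).
       stalk_map X f x a \<in> Units (stalk X x) \<longrightarrow> a \<in> Units (stalk Y (fst f x)))}"

definition rs_id :: "('p, 'r) ringed_space \<Rightarrow> ('p, 'r, 'p, 'r) rs_mor" where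
  "rs_id X = (restrict id (rs_points X),
    \<lambda>U s. if rs_open X U \<and> s \<in> carrier (rs_sec X U) then s else undefined)"

text \<open>\<open>rs_comp X Y Z g f\<close> is the composite of \<open>f\<close> from \<open>X\<close> to \<open>Y\<close> and \<open>g\<close> from \<open>Y\<close> to \<open>Z\<close>.\<close>

definition rs_comp ::
  "('p, 'r) ringed_space \<Rightarrow> ('q, 's) ringed_space \<Rightarrow> ('u, 'v) ringed_space
    \<Rightarrow> ('q, 's, 'u, 'v) rs_mor \<Rightarrow> ('p, 'r, 'q, 's) rs_mor \<Rightarrow> ('p, 'r, 'u, 'v) rs_mor" where
  "rs_comp X Y Z g f = (restrict (fst g \<circ> fst f) (rs_points X),
    \<lambda>W s. if rs_open Z W \<and> s \<in> carrier (rs_sec Z W)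
      then snd f (rs_vimage Y g W) (snd g W s) else undefined)"

definition lrs_isomorphic :: "('p, 'r) ringed_space \<Rightarrow> ('q, 's) ringed_space \<Rightarrow> bool" where
  "lrs_isomorphic X Y \<longleftrightarrow> (\<exists>f \<in> lrs_hom X Y. \<exists>g \<in> lrs_hom Y X.
    rs_comp X Y X g f = rs_id X \<and> rs_comp Y X Y f g = rs_id Y)"

definition rs_restrict :: "('p, 'r) ringed_space \<Rightarrow> 'p set \<Rightarrow> ('p, 'r) ringed_space" where
  "rs_restrict X U = X\<lparr>rs_top := subtopology (rs_top X) U\<rparr>"

section \<open>Schemes\<close>

definition zariski :: "('a, 'm) ring_scheme \<Rightarrow> 'a set topology" where
  "zariski A = topology (\<lambda>U. \<exists>E \<subseteq> carrier A. U = {P. primeideal P A \<and> \<not> E \<subseteq> P})"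

text \<open>Sections over \<open>U\<close> are the functions on \<open>U\<close> with values in the localizations that are
  locally given by fractions.\<close>

definition Spec_sections ::
  "('a, 'm) ring_scheme \<Rightarrow> 'a set set \<Rightarrow> ('a set \<Rightarrow> ('a \<times> 'a) set) set" where
  "Spec_sections A U = {s \<in> extensional U. \<forall>P \<in> U. \<exists>V a f.
     openin (zariski A) V \<and> P \<in> V \<and> V \<subseteq> U \<and> a \<in> carrier A \<and> f \<in> carrier A \<and>
     (\<forall>Q \<in> V. f \<notin> Q \<and> s Q = loc_frac A Q a f)}"

definition Spec ::
  "('a, 'm) ring_scheme \<Rightarrow> ('a set, 'a set \<Rightarrow> ('a \<times> 'a) set) ringed_space" where
  "Spec A =
    \<lparr>rs_top = zariski A,
     rs_sec = (\<lambda>U.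
       \<lparr>carrier = Spec_sections A U,
        monoid.mult = (\<lambda>s t. \<lambda>P \<in> U. s P \<otimes>\<^bsub>localization A P\<^esub> t P),
        monoid.one = (\<lambda>P \<in> U. \<one>\<^bsub>localization A P\<^esub>),
        ring.zero = (\<lambda>P \<in> U. \<zero>\<^bsub>localization A P\<^esub>),
        ring.add = (\<lambda>s t. \<lambda>P \<in> U. s P \<oplus>\<^bsub>localization A P\<^esub> t P)\<rparr>),
     rs_res = (\<lambda>U V s. restrict s V)\<rparr>"

text \<open>An affine open is isomorphic to the spectrum of its ring of sections, so rings
  with elements of type \<open>'r\<close> suffice.\<close>

definition affine_open :: "('p, 'r) ringed_space \<Rightarrow> 'p set \<Rightarrow> bool" where
  "affine_open X U \<longleftrightarrow> rs_open X U \<and>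
    (\<exists>A :: 'r ring. cring A \<and> lrs_isomorphic (rs_restrict X U) (Spec A))"

definition scheme :: "('p, 'r) ringed_space \<Rightarrow> bool" where
  "scheme X \<longleftrightarrow> locally_ringed_space X \<and> (\<forall>x \<in> rs_points X. \<exists>U. x \<in> U \<and> affine_open X U)"

definition flat_morphism ::
  "('p, 'r) ringed_space \<Rightarrow> ('q, 's) ringed_space \<Rightarrow> ('p, 'r, 'q, 's) rs_mor \<Rightarrow> bool" where
  "flat_morphism X Y f \<longleftrightarrow> (\<forall>x \<in> rs_points X.
    flat_module (stalk Y (fst f x)) (restrict_scalars (stalk_map X f x) (stalk X x)))"

section \<open>Schemes over a field\<close>

text \<open>A \<open>k\<close>-scheme is a scheme together with a morphism to \<open>Spec k\<close>. The category of \<open>k\<close>-schemes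
  consists of those with points of type \<open>'p\<close> and sections of type \<open>'r\<close>; these two
  types, which are arbitrary, play the role of the universe.\<close>

type_synonym ('p, 'r, 'k) kscheme =
  "('p, 'r) ringed_space \<times> ('p, 'r, 'k set, 'k set \<Rightarrow> ('k \<times> 'k) set) rs_mor"

type_synonym ('p, 'r) kmor = "('p, 'r, 'p, 'r) rs_mor"

definition kscheme :: "('k, 'm) ring_scheme \<Rightarrow> ('p, 'r, 'k) kscheme \<Rightarrow> bool" where
  "kscheme k S \<longleftrightarrow> scheme (fst S) \<and> snd S \<in> lrs_hom (fst S) (Spec k)"

definition k_hom ::
  "('k, 'm) ring_scheme \<Rightarrow> ('p, 'r, 'k) kscheme \<Rightarrow> ('p, 'r, 'k) kscheme \<Rightarrow> ('p, 'r) kmor set" where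
  "k_hom k S T = {f \<in> lrs_hom (fst S) (fst T).
    rs_comp (fst S) (fst T) (Spec k) (snd T) f = snd S}"

definition k_comp ::
  "('p, 'r, 'k) kscheme \<Rightarrow> ('p, 'r, 'k) kscheme \<Rightarrow> ('p, 'r, 'k) kscheme
    \<Rightarrow> ('p, 'r) kmor \<Rightarrow> ('p, 'r) kmor \<Rightarrow> ('p, 'r) kmor" where
  "k_comp S T U = rs_comp (fst S) (fst T) (fst U)"

definition k_id :: "('p, 'r, 'k) kscheme \<Rightarrow> ('p, 'r) kmor" where
  "k_id S = rs_id (fst S)"

text \<open>A covering is a set of pairs of a \<open>k\<close>-scheme and a morphism from it to \<open>U\<close>.\<close>

definition fpqc_cover ::
  "('k, 'm) ring_scheme \<Rightarrow> ('p, 'r, 'k) kscheme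
    \<Rightarrow> (('p, 'r, 'k) kscheme \<times> ('p, 'r) kmor) set \<Rightarrow> bool" where
  "fpqc_cover k U \<C> \<longleftrightarrow>
    (\<forall>(S, f) \<in> \<C>. kscheme k S \<and> f \<in> k_hom k S U \<and> flat_morphism (fst S) (fst U) f) \<and>
    (\<forall>V. affine_open (fst U) V \<longrightarrow>
      (\<exists>D. finite D \<and> (\<forall>((S, f), W) \<in> D. (S, f) \<in> \<C> \<and> affine_open (fst S) W) \<and>
         V = (\<Union>((S, f), W) \<in> D. fst f ` W)))"

section \<open>Functors on schemes\<close>

text \<open>Contravariant functors from \<open>k\<close>-schemes to sets: \<open>pb F S T f\<close> is the map from \<open>F T\<close>
  to \<open>F S\<close> induced by \<open>f\<close> from \<open>S\<close> to \<open>T\<close>.\<close>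

record ('p, 'r, 'k, 'z) presheaf =
  pt :: "('p, 'r, 'k) kscheme \<Rightarrow> 'z set"
  pb :: "('p, 'r, 'k) kscheme \<Rightarrow> ('p, 'r, 'k) kscheme \<Rightarrow> ('p, 'r) kmor \<Rightarrow> 'z \<Rightarrow> 'z"

definition presheaf :: "('k, 'm) ring_scheme \<Rightarrow> ('p, 'r, 'k, 'z) presheaf \<Rightarrow> bool" where
  "presheaf k F \<longleftrightarrow>
    (\<forall>S T f. kscheme k S \<and> kscheme k T \<and> f \<in> k_hom k S T \<longrightarrow> pb F S T f \<in> pt F T \<rightarrow> pt F S) \<and>
    (\<forall>S. kscheme k S \<longrightarrow> (\<forall>z \<in> pt F S. pb F S S (k_id S) z = z)) \<and>
    (\<forall>S T U f g. kscheme k S \<and> kscheme k T \<and> kscheme k U \<and> f \<in> k_hom k S T \<and> g \<in> k_hom k T U \<longrightarrow>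
       (\<forall>z \<in> pt F U. pb F S U (k_comp S T U g f) z = pb F S T f (pb F T U g z)))"

text \<open>The sheaf condition is phrased with matching families. By the universal property of
  fibre products, the compatibility condition over all \<open>T\<close> is equality of the two pullbacks
  to the fibre products of the members of the covering.\<close>

definition k_space :: "('k, 'm) ring_scheme \<Rightarrow> ('p, 'r, 'k, 'z) presheaf \<Rightarrow> bool" where
  "k_space k F \<longleftrightarrow> presheaf k F \<and>
    (\<forall>U \<C> x. kscheme k U \<and> fpqc_cover k U \<C> \<and>
       (\<forall>(S, f) \<in> \<C>. x (S, f) \<in> pt F S) \<and>
       (\<forall>(S, f) \<in> \<C>. \<forall>(S', f') \<in> \<C>. \<forall>T. \<forall>g \<in> k_hom k T S. \<forall>g' \<in> k_hom k T S'.
          kscheme k T \<and> k_comp T S U f g = k_comp T S' U f' g' \<longrightarrow>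
          pb F T S g (x (S, f)) = pb F T S' g' (x (S', f'))) \<longrightarrow>
       (\<exists>!z. z \<in> pt F U \<and> (\<forall>(S, f) \<in> \<C>. pb F S U f z = x (S, f))))"

definition nat_trans ::
  "('k, 'm) ring_scheme \<Rightarrow> ('p, 'r, 'k, 'y) presheaf \<Rightarrow> ('p, 'r, 'k, 'z) presheaf
    \<Rightarrow> (('p, 'r, 'k) kscheme \<Rightarrow> 'y \<Rightarrow> 'z) \<Rightarrow> bool" where
  "nat_trans k F G \<alpha> \<longleftrightarrow>
    (\<forall>S. kscheme k S \<longrightarrow> \<alpha> S \<in> pt F S \<rightarrow> pt G S) \<and>
    (\<forall>S T f. kscheme k S \<and> kscheme k T \<and> f \<in> k_hom k S T \<longrightarrow>
       (\<forall>y \<in> pt F T. \<alpha> S (pb F S T f y) = pb G S T f (\<alpha> T y)))"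

text \<open>The set of morphisms from \<open>F\<close> to \<open>G\<close>; extensionality makes its elements unique.\<close>

definition psh_maps ::
  "('k, 'm) ring_scheme \<Rightarrow> ('p, 'r, 'k, 'y) presheaf \<Rightarrow> ('p, 'r, 'k, 'z) presheaf
    \<Rightarrow> (('p, 'r, 'k) kscheme \<Rightarrow> 'y \<Rightarrow> 'z) set" where
  "psh_maps k F G = {\<alpha>. nat_trans k F G \<alpha> \<and>
    (\<forall>S y. \<not> (kscheme k S \<and> y \<in> pt F S) \<longrightarrow> \<alpha> S y = undefined)}"

definition psh_iso ::
  "('k, 'm) ring_scheme \<Rightarrow> ('p, 'r, 'k, 'y) presheaf \<Rightarrow> ('p, 'r, 'k, 'z) presheaf
    \<Rightarrow> (('p, 'r, 'k) kscheme \<Rightarrow> 'y \<Rightarrow> 'z) \<Rightarrow> bool" where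
  "psh_iso k F G \<alpha> \<longleftrightarrow> presheaf k F \<and> presheaf k G \<and> nat_trans k F G \<alpha> \<and>
    (\<exists>\<beta>. nat_trans k G F \<beta> \<and>
      (\<forall>S. kscheme k S \<longrightarrow> (\<forall>y \<in> pt F S. \<beta> S (\<alpha> S y) = y) \<and> (\<forall>z \<in> pt G S. \<alpha> S (\<beta> S z) = z)))"

definition psh_sub ::
  "('p, 'r, 'k, 'z) presheaf \<Rightarrow> (('p, 'r, 'k) kscheme \<Rightarrow> 'z set) \<Rightarrow> ('p, 'r, 'k, 'z) presheaf" where
  "psh_sub F P = F\<lparr>pt := P\<rparr>"

definition psh_prod ::
  "('p, 'r, 'k, 'y) presheaf \<Rightarrow> ('p, 'r, 'k, 'z) presheaf \<Rightarrow> ('p, 'r, 'k, 'y \<times> 'z) presheaf" where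
  "psh_prod F G =
    \<lparr>pt = (\<lambda>S. pt F S \<times> pt G S), pb = (\<lambda>S T f. map_prod (pb F S T f) (pb G S T f))\<rparr>"

definition fiber_prod ::
  "('p, 'r, 'k, 'y) presheaf \<Rightarrow> (('p, 'r, 'k) kscheme \<Rightarrow> 'y \<Rightarrow> 'x)
    \<Rightarrow> ('p, 'r, 'k, 'z) presheaf \<Rightarrow> (('p, 'r, 'k) kscheme \<Rightarrow> 'z \<Rightarrow> 'x)
    \<Rightarrow> ('p, 'r, 'k, 'y \<times> 'z) presheaf" where
  "fiber_prod F \<alpha> G \<beta> =
    psh_sub (psh_prod F G) (\<lambda>S. {(y, z). y \<in> pt F S \<and> z \<in> pt G S \<and> \<alpha> S y = \<beta> S z})"

definition yoneda ::
  "('k, 'm) ring_scheme \<Rightarrow> ('p, 'r, 'k) kscheme \<Rightarrow> ('p, 'r, 'k, ('p, 'r) kmor) presheaf" where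
  "yoneda k S = \<lparr>pt = (\<lambda>T. k_hom k T S), pb = (\<lambda>T T' f g. k_comp T T' S g f)\<rparr>"

text \<open>The morphism from \<open>yoneda k S\<close> to \<open>F\<close> that corresponds to an element of \<open>F S\<close>.\<close>

definition yoneda_map ::
  "('p, 'r, 'k, 'z) presheaf \<Rightarrow> ('p, 'r, 'k) kscheme \<Rightarrow> 'z
    \<Rightarrow> ('p, 'r, 'k) kscheme \<Rightarrow> ('p, 'r) kmor \<Rightarrow> 'z" where
  "yoneda_map F S z T g = pb F T S g z"

section \<open>The affine line, the multiplicative group and their action on the plane\<close>

definition global_sections :: "('p, 'r, 'k) kscheme \<Rightarrow> 'r ring" where
  "global_sections S = rs_sec (fst S) (rs_points (fst S))"

text \<open>Affine spaces over \<open>k\<close> are identified with the functors they represent: a morphism of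
  \<open>k\<close>-schemes from \<open>S\<close> to \<open>Spec k[\<tau>\<^sub>1, \<dots>, \<tau>\<^sub>n]\<close> is an \<open>n\<close>-tuple of global sections of \<open>S\<close>.
  Such a morphism factors through the complement of the origin of the affine line exactly if
  the global section is invertible.\<close>

definition A1 :: "('p, 'r, 'k, 'r) presheaf" where
  "A1 = \<lparr>pt = (\<lambda>S. carrier (global_sections S)), pb = (\<lambda>S T f. snd f (rs_points (fst T)))\<rparr>"

definition Gm :: "('p, 'r, 'k, 'r) presheaf" where
  "Gm = psh_sub A1 (\<lambda>S. Units (global_sections S))"

definition Gm_action ::
  "('k, 'm) ring_scheme \<Rightarrow> ('p, 'r, 'k, 'z) presheaf
    \<Rightarrow> (('p, 'r, 'k) kscheme \<Rightarrow> 'r \<Rightarrow> 'z \<Rightarrow> 'z) \<Rightarrow> bool" where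
  "Gm_action k Z act \<longleftrightarrow>
    nat_trans k (psh_prod Gm Z) Z (\<lambda>S (l, z). act S l z) \<and>
    (\<forall>S. kscheme k S \<longrightarrow> (\<forall>z \<in> pt Z S.
       act S \<one>\<^bsub>global_sections S\<^esub> z = z \<and>
       (\<forall>l \<in> pt Gm S. \<forall>m \<in> pt Gm S.
          act S (l \<otimes>\<^bsub>global_sections S\<^esub> m) z = act S l (act S m z))))"

definition XX :: "('p, 'r, 'k, 'r \<times> 'r) presheaf" where
  "XX = psh_prod A1 A1"

definition XX_proj :: "('p, 'r, 'k) kscheme \<Rightarrow> 'r \<times> 'r \<Rightarrow> 'r" where
  "XX_proj S = (\<lambda>(x, y). x \<otimes>\<^bsub>global_sections S\<^esub> y)"

definition XX_act :: "('p, 'r, 'k) kscheme \<Rightarrow> 'r \<Rightarrow> 'r \<times> 'r \<Rightarrow> 'r \<times> 'r" where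
  "XX_act S l = (\<lambda>(x, y). (l \<otimes>\<^bsub>global_sections S\<^esub> x,
     inv\<^bsub>global_sections S\<^esub> l \<otimes>\<^bsub>global_sections S\<^esub> y))"

text \<open>A scheme over the affine line is a \<open>k\<close>-scheme \<open>S\<close> with \<open>t \<in> pt A1 S\<close>. The following is
  the fibre product of \<open>XX\<close> and \<open>S\<close> over the affine line.\<close>

definition XX_over ::
  "('k, 'm) ring_scheme \<Rightarrow> ('p, 'r, 'k) kscheme \<Rightarrow> 'r
    \<Rightarrow> ('p, 'r, 'k, ('r \<times> 'r) \<times> ('p, 'r) kmor) presheaf" where
  "XX_over k S t = fiber_prod XX XX_proj (yoneda k S) (yoneda_map A1 S t)"

definition equivariant_maps ::
  "('k, 'm) ring_scheme \<Rightarrow> ('p, 'r, 'k, 'z) presheaf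
    \<Rightarrow> (('p, 'r, 'k) kscheme \<Rightarrow> 'r \<Rightarrow> 'z \<Rightarrow> 'z) \<Rightarrow> ('p, 'r, 'k) kscheme \<Rightarrow> 'r
    \<Rightarrow> (('p, 'r, 'k) kscheme \<Rightarrow> ('r \<times> 'r) \<times> ('p, 'r) kmor \<Rightarrow> 'z) set" where
  "equivariant_maps k Z act S t = {\<phi> \<in> psh_maps k (XX_over k S t) Z.
    \<forall>T. kscheme k T \<longrightarrow> (\<forall>l \<in> pt Gm T. \<forall>(x, g) \<in> pt (XX_over k S t) T.
      \<phi> T (XX_act T l x, g) = act T l (\<phi> T (x, g)))}"

section \<open>The space of equivariant maps\<close>

text \<open>An \<open>S\<close>-point is a morphism \<open>t\<close> from \<open>S\<close> to the affine line together with a lift over the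
  affine line, that is, an equivariant morphism from \<open>XX_over k S t\<close> to \<open>Z\<close>. Pullback along \<open>f\<close>
  from \<open>S\<close> to \<open>T\<close> composes it with the morphism of fibre products induced by \<open>f\<close>.\<close>

definition Ztilde ::
  "('k, 'm) ring_scheme \<Rightarrow> ('p, 'r, 'k, 'z) presheaf
    \<Rightarrow> (('p, 'r, 'k) kscheme \<Rightarrow> 'r \<Rightarrow> 'z \<Rightarrow> 'z)
    \<Rightarrow> ('p, 'r, 'k,
        'r \<times> (('p, 'r, 'k) kscheme \<Rightarrow> ('r \<times> 'r) \<times> ('p, 'r) kmor \<Rightarrow> 'z)) presheaf" where
  "Ztilde k Z act =
    \<lparr>pt = (\<lambda>S. {(t, \<phi>). t \<in> pt A1 S \<and> \<phi> \<in> equivariant_maps k Z act S t}),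
     pb = (\<lambda>S T f (t, \<phi>). (pb A1 S T f t,
       \<lambda>U (x, g). if kscheme k U \<and> (x, g) \<in> pt (XX_over k S (pb A1 S T f t)) U
         then \<phi> U (x, k_comp U S T f g) else undefined))\<rparr>"

text \<open>A section \<open>\<sigma>\<close> of \<open>XX\<close> over the affine line pulls back to a section of \<open>XX_over k S t\<close>
  over \<open>S\<close>, whose composite with \<open>\<phi>\<close> is an element of \<open>Z S\<close> by the Yoneda lemma.\<close>

definition section_pullback ::
  "(('p, 'r, 'k) kscheme \<Rightarrow> 'r \<Rightarrow> 'r \<times> 'r) \<Rightarrow> ('p, 'r, 'k) kscheme
    \<Rightarrow> 'r \<times> (('p, 'r, 'k) kscheme \<Rightarrow> ('r \<times> 'r) \<times> ('p, 'r) kmor \<Rightarrow> 'z) \<Rightarrow> 'z" where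
  "section_pullback \<sigma> S = (\<lambda>(t, \<phi>). \<phi> S (\<sigma> S t, k_id S))"

definition pi1 ::
  "('p, 'r, 'k) kscheme
    \<Rightarrow> 'r \<times> (('p, 'r, 'k) kscheme \<Rightarrow> ('r \<times> 'r) \<times> ('p, 'r) kmor \<Rightarrow> 'z) \<Rightarrow> 'z" where
  "pi1 = section_pullback (\<lambda>S t. (\<one>\<^bsub>global_sections S\<^esub>, t))"

definition pi2 ::
  "('p, 'r, 'k) kscheme
    \<Rightarrow> 'r \<times> (('p, 'r, 'k) kscheme \<Rightarrow> ('r \<times> 'r) \<times> ('p, 'r) kmor \<Rightarrow> 'z) \<Rightarrow> 'z" where
  "pi2 = section_pullback (\<lambda>S t. (t, \<one>\<^bsub>global_sections S\<^esub>))"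

definition ptilde ::
  "('p, 'r, 'k) kscheme
    \<Rightarrow> 'r \<times> (('p, 'r, 'k) kscheme \<Rightarrow> ('r \<times> 'r) \<times> ('p, 'r) kmor \<Rightarrow> 'z) \<Rightarrow> 'r \<times> 'z \<times> 'z" where
  "ptilde S \<zeta> = (fst \<zeta>, pi1 S \<zeta>, pi2 S \<zeta>)"

definition Ztilde_over_Gm ::
  "('k, 'm) ring_scheme \<Rightarrow> ('p, 'r, 'k, 'z) presheaf
    \<Rightarrow> (('p, 'r, 'k) kscheme \<Rightarrow> 'r \<Rightarrow> 'z \<Rightarrow> 'z)
    \<Rightarrow> ('p, 'r, 'k,
        'r \<times> (('p, 'r, 'k) kscheme \<Rightarrow> ('r \<times> 'r) \<times> ('p, 'r) kmor \<Rightarrow> 'z)) presheaf" where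
  "Ztilde_over_Gm k Z act =
    psh_sub (Ztilde k Z act) (\<lambda>S. {\<zeta> \<in> pt (Ztilde k Z act) S. fst \<zeta> \<in> pt Gm S})"

definition action_graph ::
  "('p, 'r, 'k, 'z) presheaf \<Rightarrow> (('p, 'r, 'k) kscheme \<Rightarrow> 'r \<Rightarrow> 'z \<Rightarrow> 'z)
    \<Rightarrow> ('p, 'r, 'k, 'r \<times> 'z \<times> 'z) presheaf" where
  "action_graph Z act = psh_sub (psh_prod Gm (psh_prod Z Z))
    (\<lambda>S. {(t, z1, z2). t \<in> pt Gm S \<and> z1 \<in> pt Z S \<and> z2 \<in> pt Z S \<and> act S t z1 = z2})"

end

theory Submission
  imports Defs "HOL-Algebra.Divisibility"
begin

text \<open>Over a point \<open>t\<close> of \<open>Gm\<close>, the fibre \<open>x y = t\<close> of \<open>XX\<close> over the affine line is the hyperbola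
  on which \<open>x\<close> is invertible and \<open>y\<close> is determined by \<open>x\<close>. It is a principal homogeneous space
  under \<open>Gm\<close>, with base point \<open>(1, t)\<close>. An equivariant map from a principal homogeneous space with
  a base point is the same thing as a point of the target, the value at the base point. Thus a
  point of \<open>Ztilde\<close> over \<open>t\<close> is determined by \<open>z1 = pi1\<close>, and every point \<open>z1\<close> of \<open>Z\<close> arises. The
  map with value \<open>z1\<close> at the base point sends \<open>(x, y)\<close> to \<open>x z1\<close>; in particular its value at
  \<open>(t, 1) = t (1, t)\<close>, which is \<open>pi2\<close>, is \<open>t z1\<close>. So the image of \<open>ptilde\<close> over \<open>Gm\<close> is the graph
  of the action, and \<open>(t, z1, z2) \<mapsto> (t, (x, y) \<mapsto> x z1)\<close> is the inverse.

  In terms of functors, the map \<open>(x, y) \<mapsto> x z1\<close> is \<open>orbit_map\<close>; it exists because \<open>x\<close> is a unit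
  (\<open>XX_over_fst_unit\<close>). That it is the only equivariant map with its value at the base point is
  \<open>equivariant_maps_eq_orbit_map\<close>, and its compatibility with change of \<open>S\<close>, which makes the
  inverse natural, is \<open>orbit_map_base_change\<close>. The relation between the two evaluations is
  \<open>act_pi1_eq_pi2\<close>.

  All of this takes place on points over a single scheme \<open>U\<close>. Relating different schemes requires
  that schemes over \<open>k\<close> form a category and that global sections, hence \<open>A1\<close> and \<open>Gm\<close>, are
  functors on it. The one delicate point there is that the composite of two local morphisms of
  ringed spaces is again local (\<open>rs_comp_in_lrs_hom\<close>).\<close>

section \<open>Composition of morphisms of locally ringed spaces\<close>

lemma rs_vimage_open:
  assumes "f \<in> lrs_hom X Y" and "rs_open Y V"
  shows "rs_open X (rs_vimage X f V)"
  using assms unfolding lrs_hom_def rs_vimage_def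
  by (auto intro: openin_continuous_map_preimage)

lemma lrs_hom_point:
  assumes "f \<in> lrs_hom X Y" and "x \<in> rs_points X"
  shows "fst f x \<in> rs_points Y"
  using assms unfolding lrs_hom_def by (auto dest: continuous_map_image_subset_topspace)

lemma rs_vimage_points:
  assumes "f \<in> lrs_hom X Y"
  shows "rs_vimage X f (rs_points Y) = rs_points X"
  using lrs_hom_point[OF assms] by (auto simp: rs_vimage_def)

lemma lrs_hom_ring_hom:
  assumes "f \<in> lrs_hom X Y" and "rs_open Y V"
  shows "snd f V \<in> ring_hom (rs_sec Y V) (rs_sec X (rs_vimage X f V))"
  using assms unfolding lrs_hom_def by blast

lemma lrs_hom_sec_closed:
  assumes "f \<in> lrs_hom X Y" and "rs_open Y V" and "s \<in> carrier (rs_sec Y V)"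
  shows "snd f V s \<in> carrier (rs_sec X (rs_vimage X f V))"
  using lrs_hom_ring_hom[OF assms(1,2)] assms(3) by (rule ring_hom_closed)

lemma lrs_hom_undefined:
  assumes "f \<in> lrs_hom X Y" and "\<not> (rs_open Y V \<and> s \<in> carrier (rs_sec Y V))"
  shows "snd f V s = undefined"
proof -
  have "\<forall>V s. \<not> (rs_open Y V \<and> s \<in> carrier (rs_sec Y V)) \<longrightarrow> snd f V s = undefined"
    using assms(1) unfolding lrs_hom_def mem_Collect_eq by (elim conjE)
  then show ?thesis
    using assms(2) by (elim allE impE)
qed

lemma lrs_hom_res:
  assumes "f \<in> lrs_hom X Y" and "rs_open Y U" and "rs_open Y V" and "V \<subseteq> U"
    and "s \<in> carrier (rs_sec Y U)"
  shows "rs_res X (rs_vimage X f U) (rs_vimage X f V) (snd f U s) = snd f V (rs_res Y U V s)"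
  using assms unfolding lrs_hom_def by blast

lemma lrs_hom_local:
  assumes "f \<in> lrs_hom X Y" and "x \<in> rs_points X" and "a \<in> carrier (stalk Y (fst f x))"
    and "stalk_map X f x a \<in> Units (stalk X x)"
  shows "a \<in> Units (stalk Y (fst f x))"
  using assms unfolding lrs_hom_def by blast

lemma rs_vimage_comp:
  assumes "f \<in> lrs_hom X Y"
  shows "rs_vimage X (rs_comp X Y Z g f) W = rs_vimage X f (rs_vimage Y g W)"
  using lrs_hom_point[OF assms] by (auto simp: rs_vimage_def rs_comp_def)

lemma rs_vimage_id: "V \<subseteq> rs_points X \<Longrightarrow> rs_vimage X (rs_id X) V = V"
  by (auto simp: rs_vimage_def rs_id_def)

text \<open>A composite is \<open>undefined\<close> off its domain, so associativity holds because the
  intermediate points and sections stay inside the domains of the next map.\<close>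

lemma rs_comp_assoc:
  assumes f: "f \<in> lrs_hom X Y" and g: "g \<in> lrs_hom Y Z" and h: "h \<in> lrs_hom Z W"
  shows "rs_comp X Z W h (rs_comp X Y Z g f) = rs_comp X Y W (rs_comp Y Z W h g) f"
proof (rule prod_eqI)
  show "fst (rs_comp X Z W h (rs_comp X Y Z g f)) = fst (rs_comp X Y W (rs_comp Y Z W h g) f)"
    using lrs_hom_point[OF f] by (auto simp: rs_comp_def fun_eq_iff)
  show "snd (rs_comp X Z W h (rs_comp X Y Z g f)) = snd (rs_comp X Y W (rs_comp Y Z W h g) f)"
  proof (intro ext)
    fix V s
    show "snd (rs_comp X Z W h (rs_comp X Y Z g f)) V s
      = snd (rs_comp X Y W (rs_comp Y Z W h g) f) V s"
      using rs_vimage_open[OF h] lrs_hom_sec_closed[OF h]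
      by (simp add: rs_comp_def rs_vimage_comp[OF g, unfolded rs_comp_def])
  qed
qed

lemma rs_comp_id_left:
  assumes f: "f \<in> lrs_hom X Y"
  shows "rs_comp X Y Y (rs_id Y) f = f"
proof (rule prod_eqI)
  have "fst f \<in> extensional (rs_points X)"
    using f unfolding lrs_hom_def by blast
  then show "fst (rs_comp X Y Y (rs_id Y) f) = fst f"
    using lrs_hom_point[OF f] by (auto simp: rs_comp_def rs_id_def fun_eq_iff extensional_def)
  show "snd (rs_comp X Y Y (rs_id Y) f) = snd f"
  proof (intro ext)
    fix V s
    show "snd (rs_comp X Y Y (rs_id Y) f) V s = snd f V s"
    proof (cases "rs_open Y V \<and> s \<in> carrier (rs_sec Y V)")
      case True
      then have "rs_vimage Y (rs_id Y) V = V"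
        by (simp add: rs_vimage_id openin_subset)
      with True show ?thesis
        by (simp add: rs_comp_def rs_id_def)
    next
      case False
      then show ?thesis
        using lrs_hom_undefined[OF f False] by (auto simp: rs_comp_def)
    qed
  qed
qed

lemma rs_comp_id_right:
  assumes f: "f \<in> lrs_hom X Y"
  shows "rs_comp X X Y f (rs_id X) = f"
proof (rule prod_eqI)
  have "fst f \<in> extensional (rs_points X)"
    using f unfolding lrs_hom_def by blast
  then show "fst (rs_comp X X Y f (rs_id X)) = fst f"
    by (intro extensionalityI[of _ "rs_points X"]) (simp_all add: rs_comp_def rs_id_def)
  show "snd (rs_comp X X Y f (rs_id X)) = snd f"
  proof (intro ext)
    fix V s
    show "snd (rs_comp X X Y f (rs_id X)) V s = snd f V s"
    proof (cases "rs_open Y V \<and> s \<in> carrier (rs_sec Y V)")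
      case True
      then show ?thesis
        using rs_vimage_open[OF f, of V] lrs_hom_sec_closed[OF f, of V s]
        by (simp add: rs_comp_def rs_id_def)
    next
      case False
      then show ?thesis
        using lrs_hom_undefined[OF f False] by (auto simp: rs_comp_def)
    qed
  qed
qed

lemma ringed_space_cring:
  assumes "ringed_space X" and "rs_open X U"
  shows "cring (rs_sec X U)"
proof -
  have "\<forall>U. rs_open X U \<longrightarrow> cring (rs_sec X U)"
    using assms(1) unfolding ringed_space_def by (elim conjE)
  then show ?thesis
    using assms(2) by simp
qed

lemma ringed_space_res_hom:
  assumes "ringed_space X" and "rs_open X U" and "rs_open X V" and "V \<subseteq> U"
  shows "rs_res X U V \<in> ring_hom (rs_sec X U) (rs_sec X V)"
proof -
  have "\<forall>U V. rs_open X U \<and> rs_open X V \<and> V \<subseteq> U \<longrightarrow>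
      rs_res X U V \<in> ring_hom (rs_sec X U) (rs_sec X V)"
    using assms(1) unfolding ringed_space_def by (elim conjE)
  then show ?thesis
    using assms(2-4) by simp
qed

lemma ringed_space_res_res:
  assumes "ringed_space X" and "rs_open X U" and "rs_open X V" and "rs_open X W"
    and "W \<subseteq> V" and "V \<subseteq> U" and "s \<in> carrier (rs_sec X U)"
  shows "rs_res X V W (rs_res X U V s) = rs_res X U W s"
proof -
  have "\<forall>U V W s. rs_open X U \<and> rs_open X V \<and> rs_open X W \<and> W \<subseteq> V \<and> V \<subseteq> U \<and>
      s \<in> carrier (rs_sec X U) \<longrightarrow> rs_res X V W (rs_res X U V s) = rs_res X U W s"
    using assms(1) unfolding ringed_space_def by (elim conjE)
  then show ?thesis
    using assms(2-7) by simp
qed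

lemma germ_self:
  assumes "rs_open X U" and "x \<in> U" and "s \<in> carrier (rs_sec X U)"
  shows "(U, s) \<in> germ X x U s"
  using assms unfolding germ_def by auto

text \<open>Transitivity of the relation that defines germs: two agreements, on \<open>W\<close> and on \<open>W'\<close>, give
  an agreement on \<open>W \<inter> W'\<close>. Hence the germs at a point are equivalence classes.\<close>

lemma germ_subset:
  assumes X: "ringed_space X" and U: "rs_open X U" "s \<in> carrier (rs_sec X U)"
    and V: "rs_open X V" "t \<in> carrier (rs_sec X V)"
    and W: "rs_open X W" "x \<in> W" "W \<subseteq> U \<inter> V" "rs_res X U W s = rs_res X V W t"
  shows "germ X x V t \<subseteq> germ X x U s"
proof clarify
  fix V' t' assume "(V', t') \<in> germ X x V t"
  then obtain W' where V': "rs_open X V'" "x \<in> V'" "t' \<in> carrier (rs_sec X V')"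
    and W': "rs_open X W'" "x \<in> W'" "W' \<subseteq> V \<inter> V'" "rs_res X V W' t = rs_res X V' W' t'"
    unfolding germ_def by auto
  let ?N = "W \<inter> W'"
  have N: "rs_open X ?N"
    using W W' by auto
  have "rs_res X U ?N s = rs_res X W ?N (rs_res X U W s)"
    using W by (intro ringed_space_res_res[symmetric] X U N) auto
  also have "\<dots> = rs_res X V ?N t"
    unfolding W(4) using W by (intro ringed_space_res_res X V N) auto
  also have "\<dots> = rs_res X W' ?N (rs_res X V W' t)"
    using W' by (intro ringed_space_res_res[symmetric] X V N) auto
  also have "\<dots> = rs_res X V' ?N t'"
    unfolding W'(4) using W' by (intro ringed_space_res_res X V' N) auto
  finally show "(V', t') \<in> germ X x U s"
    using V' W W' N unfolding germ_def by blast
qed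

lemma germ_eqI:
  assumes "ringed_space X" and "rs_open X U" "s \<in> carrier (rs_sec X U)"
    and "rs_open X V" "t \<in> carrier (rs_sec X V)"
    and "rs_open X W" "x \<in> W" "W \<subseteq> U \<inter> V" "rs_res X U W s = rs_res X V W t"
  shows "germ X x U s = germ X x V t"
proof
  show "germ X x V t \<subseteq> germ X x U s"
    using assms by (rule germ_subset)
  show "germ X x U s \<subseteq> germ X x V t"
    using assms by (intro germ_subset[of X V t U s W x]) auto
qed

text \<open>\<open>stalk_map\<close> is a union over all representatives of a germ, and all of them contribute the same
  germ. Stated for morphisms of ringed spaces, because it is used to verify locality
  in \<open>lrs_homI\<close>.\<close>

lemma stalk_map_germ:
  assumes X: "ringed_space X"
    and cont: "continuous_map (rs_top X) (rs_top Y) (fst f)"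
    and closed: "\<And>V s. rs_open Y V \<Longrightarrow> s \<in> carrier (rs_sec Y V) \<Longrightarrow>
      snd f V s \<in> carrier (rs_sec X (rs_vimage X f V))"
    and res: "\<And>U V s. rs_open Y U \<Longrightarrow> rs_open Y V \<Longrightarrow> V \<subseteq> U \<Longrightarrow> s \<in> carrier (rs_sec Y U) \<Longrightarrow>
      rs_res X (rs_vimage X f U) (rs_vimage X f V) (snd f U s) = snd f V (rs_res Y U V s)"
    and x: "x \<in> rs_points X"
    and V: "rs_open Y V" "fst f x \<in> V" "s \<in> carrier (rs_sec Y V)"
  shows "stalk_map X f x (germ Y (fst f x) V s) = germ X x (rs_vimage X f V) (snd f V s)"
proof -
  have vim_open: "rs_open X (rs_vimage X f U)" if "rs_open Y U" for U
    using cont that unfolding rs_vimage_def by (rule openin_continuous_map_preimage)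
  have "germ X x (rs_vimage X f V') (snd f V' s') = germ X x (rs_vimage X f V) (snd f V s)"
    if "(V', s') \<in> germ Y (fst f x) V s" for V' s'
  proof -
    obtain W where V': "rs_open Y V'" "s' \<in> carrier (rs_sec Y V')"
      and W: "rs_open Y W" "fst f x \<in> W" "W \<subseteq> V \<inter> V'" "rs_res Y V W s = rs_res Y V' W s'"
      using \<open>(V', s') \<in> germ Y (fst f x) V s\<close> unfolding germ_def by auto
    have "rs_res X (rs_vimage X f V') (rs_vimage X f W) (snd f V' s')
      = rs_res X (rs_vimage X f V) (rs_vimage X f W) (snd f V s)"
      using res[of V' W s'] res[of V W s] V V' W by auto
    then show ?thesis
      using V V' W x
      by (intro germ_eqI[of X _ _ _ _ "rs_vimage X f W"] X vim_open closed)
        (auto simp: rs_vimage_def)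
  qed
  then have "(case p of (V', s') \<Rightarrow> germ X x (rs_vimage X f V') (snd f V' s'))
      = germ X x (rs_vimage X f V) (snd f V s)" if "p \<in> germ Y (fst f x) V s" for p
    using that unfolding split_def by (metis prod.collapse)
  then show ?thesis
    unfolding stalk_map_def using germ_self[OF V] by (blast intro: SUP_eq_const)
qed

lemma stalkE:
  assumes "a \<in> carrier (stalk X x)"
  obtains U s where "rs_open X U" "x \<in> U" "s \<in> carrier (rs_sec X U)" "a = germ X x U s"
  using assms unfolding stalk_def by auto

lemma germ_in_stalk:
  "rs_open X U \<Longrightarrow> x \<in> U \<Longrightarrow> s \<in> carrier (rs_sec X U) \<Longrightarrow> germ X x U s \<in> carrier (stalk X x)"
  unfolding stalk_def by auto

text \<open>Locality, which the definition expresses through elements of the stalk, becomes a condition on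
  representatives, where composites can be computed.\<close>

lemma lrs_homI:
  assumes "continuous_map (rs_top X) (rs_top Y) (fst f)"
    and "fst f \<in> extensional (rs_points X)"
    and "\<And>V s. \<not> (rs_open Y V \<and> s \<in> carrier (rs_sec Y V)) \<Longrightarrow> snd f V s = undefined"
    and "\<And>V. rs_open Y V \<Longrightarrow> snd f V \<in> ring_hom (rs_sec Y V) (rs_sec X (rs_vimage X f V))"
    and "\<And>U V s. rs_open Y U \<Longrightarrow> rs_open Y V \<Longrightarrow> V \<subseteq> U \<Longrightarrow> s \<in> carrier (rs_sec Y U) \<Longrightarrow>
      rs_res X (rs_vimage X f U) (rs_vimage X f V) (snd f U s) = snd f V (rs_res Y U V s)"
    and "\<And>x V s. x \<in> rs_points X \<Longrightarrow> rs_open Y V \<Longrightarrow> fst f x \<in> V \<Longrightarrow> s \<in> carrier (rs_sec Y V) \<Longrightarrow>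
      germ X x (rs_vimage X f V) (snd f V s) \<in> Units (stalk X x) \<Longrightarrow>
      germ Y (fst f x) V s \<in> Units (stalk Y (fst f x))"
    and X: "ringed_space X"
  shows "f \<in> lrs_hom X Y"
proof -
  have "a \<in> Units (stalk Y (fst f x))"
    if x: "x \<in> rs_points X" and "a \<in> carrier (stalk Y (fst f x))"
      and unit: "stalk_map X f x a \<in> Units (stalk X x)" for x a
  proof -
    from that obtain V s where V: "rs_open Y V" "fst f x \<in> V" "s \<in> carrier (rs_sec Y V)"
      and a: "a = germ Y (fst f x) V s"
      by (auto elim: stalkE)
    have "stalk_map X f x a = germ X x (rs_vimage X f V) (snd f V s)"
      unfolding a using X assms(1) ring_hom_closed[OF assms(4)] assms(5) x V
      by (rule stalk_map_germ)
    with unit show ?thesis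
      using assms(6)[OF x V] a by simp
  qed
  then show ?thesis
    using assms(1-5) unfolding lrs_hom_def by blast
qed

lemma lrs_hom_germ_unit:
  assumes X: "ringed_space X" and f: "f \<in> lrs_hom X Y" and x: "x \<in> rs_points X"
    and V: "rs_open Y V" "fst f x \<in> V" "s \<in> carrier (rs_sec Y V)"
    and unit: "germ X x (rs_vimage X f V) (snd f V s) \<in> Units (stalk X x)"
  shows "germ Y (fst f x) V s \<in> Units (stalk Y (fst f x))"
proof -
  have cont: "continuous_map (rs_top X) (rs_top Y) (fst f)"
    using f unfolding lrs_hom_def by blast
  have "stalk_map X f x (germ Y (fst f x) V s) = germ X x (rs_vimage X f V) (snd f V s)"
    using X cont lrs_hom_sec_closed[OF f] lrs_hom_res[OF f] x V by (rule stalk_map_germ)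
  with unit have "stalk_map X f x (germ Y (fst f x) V s) \<in> Units (stalk X x)"
    by simp
  with f x germ_in_stalk[OF V] show ?thesis
    by (rule lrs_hom_local)
qed

lemma rs_id_in_lrs_hom:
  assumes X: "ringed_space X"
  shows "rs_id X \<in> lrs_hom X X"
proof (rule lrs_homI[OF _ _ _ _ _ _ X])
  have vim: "rs_vimage X (rs_id X) V = V" if "rs_open X V" for V
    using that by (simp add: rs_vimage_id openin_subset)
  show "continuous_map (rs_top X) (rs_top X) (fst (rs_id X))"
    by (rule continuous_map_eq[OF continuous_map_id]) (auto simp: rs_id_def)
  show "snd (rs_id X) V \<in> ring_hom (rs_sec X V) (rs_sec X (rs_vimage X (rs_id X) V))"
    if "rs_open X V" for V
    using that ringed_space_cring[OF X that] unfolding vim[OF that]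
    by (auto simp: rs_id_def ring_hom_def cring_def ring.ring_simprules)
  show "rs_res X (rs_vimage X (rs_id X) U) (rs_vimage X (rs_id X) V) (snd (rs_id X) U s)
      = snd (rs_id X) V (rs_res X U V s)"
    if "rs_open X U" "rs_open X V" "V \<subseteq> U" "s \<in> carrier (rs_sec X U)" for U V s
    using that ring_hom_closed[OF ringed_space_res_hom[OF X that(1-3)] that(4)]
    unfolding vim[OF that(1)] vim[OF that(2)] by (simp add: rs_id_def)
  show "germ X (fst (rs_id X) x) V s \<in> Units (stalk X (fst (rs_id X) x))"
    if "x \<in> rs_points X" "rs_open X V" "s \<in> carrier (rs_sec X V)"
      "germ X x (rs_vimage X (rs_id X) V) (snd (rs_id X) V s) \<in> Units (stalk X x)" for x V s
    using that unfolding vim[OF that(2)] by (simp add: rs_id_def)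
  show "fst (rs_id X) \<in> extensional (rs_points X)"
    by (simp add: rs_id_def)
  show "snd (rs_id X) V s = undefined" if "\<not> (rs_open X V \<and> s \<in> carrier (rs_sec X V))" for V s
    using that unfolding rs_id_def by (simp only: snd_conv if_False)
qed

lemma rs_comp_in_lrs_hom:
  assumes X: "ringed_space X" and Y: "ringed_space Y" and Z: "ringed_space Z"
    and f: "f \<in> lrs_hom X Y" and g: "g \<in> lrs_hom Y Z"
  shows "rs_comp X Y Z g f \<in> lrs_hom X Z" (is "?h \<in> _")
proof (rule lrs_homI[OF _ _ _ _ _ _ X])
  note vim = rs_vimage_comp[OF f, of Z g]
  have "continuous_map (rs_top X) (rs_top Z) (fst g \<circ> fst f)"
    using f g unfolding lrs_hom_def by (auto intro: continuous_map_compose)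
  then show "continuous_map (rs_top X) (rs_top Z) (fst ?h)"
    by (rule continuous_map_eq) (simp add: rs_comp_def)
  show "snd ?h V \<in> ring_hom (rs_sec Z V) (rs_sec X (rs_vimage X ?h V))"
    if V: "rs_open Z V" for V
  proof -
    have "snd f (rs_vimage Y g V) \<circ> snd g V
      \<in> ring_hom (rs_sec Z V) (rs_sec X (rs_vimage X f (rs_vimage Y g V)))"
      by (rule ring_hom_trans[OF lrs_hom_ring_hom[OF g V]
            lrs_hom_ring_hom[OF f rs_vimage_open[OF g V]]])
    then show ?thesis
      using V ringed_space_cring[OF Z V] unfolding vim
      by (auto simp: rs_comp_def ring_hom_def cring_def ring.ring_simprules)
  qed
  show "rs_res X (rs_vimage X ?h U) (rs_vimage X ?h V) (snd ?h U s)
      = snd ?h V (rs_res Z U V s)"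
    if U: "rs_open Z U" and V: "rs_open Z V" and "V \<subseteq> U" and s: "s \<in> carrier (rs_sec Z U)"
    for U V s
  proof -
    have "rs_vimage Y g V \<subseteq> rs_vimage Y g U"
      using \<open>V \<subseteq> U\<close> by (auto simp: rs_vimage_def)
    moreover have "rs_res Z U V s \<in> carrier (rs_sec Z V)"
      using ringed_space_res_hom[OF Z U V \<open>V \<subseteq> U\<close>] s by (rule ring_hom_closed)
    ultimately show ?thesis
      using U V s lrs_hom_res[OF g U V \<open>V \<subseteq> U\<close> s]
        lrs_hom_res[OF f rs_vimage_open[OF g U] rs_vimage_open[OF g V] _
          lrs_hom_sec_closed[OF g U s]]
      unfolding vim by (simp add: rs_comp_def)
  qed
  show "germ Z (fst ?h x) V s \<in> Units (stalk Z (fst ?h x))"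
    if x: "x \<in> rs_points X" and V: "rs_open Z V" "fst ?h x \<in> V" "s \<in> carrier (rs_sec Z V)"
      and unit: "germ X x (rs_vimage X ?h V) (snd ?h V s) \<in> Units (stalk X x)" for x V s
  proof -
    have fst_h: "fst ?h x = fst g (fst f x)"
      using x by (simp add: rs_comp_def)
    have y: "fst f x \<in> rs_points Y"
      using f x by (rule lrs_hom_point)
    have "germ X x (rs_vimage X f (rs_vimage Y g V)) (snd f (rs_vimage Y g V) (snd g V s))
      \<in> Units (stalk X x)"
      using unit V unfolding vim by (simp add: rs_comp_def)
    then have "germ Y (fst f x) (rs_vimage Y g V) (snd g V s) \<in> Units (stalk Y (fst f x))"
      using V y fst_h
      by (intro lrs_hom_germ_unit[OF X f x] rs_vimage_open[OF g] lrs_hom_sec_closed[OF g])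
        (auto simp: rs_vimage_def)
    then show ?thesis
      using V unfolding fst_h by (intro lrs_hom_germ_unit[OF Y g y])
  qed
  show "fst ?h \<in> extensional (rs_points X)"
    by (simp add: rs_comp_def)
  show "snd ?h V s = undefined" if "\<not> (rs_open Z V \<and> s \<in> carrier (rs_sec Z V))" for V s
    using that unfolding rs_comp_def by (simp only: snd_conv if_False)
qed

section \<open>The category of schemes over a field\<close>

lemma kscheme_ringed_space: "kscheme k S \<Longrightarrow> ringed_space (fst S)"
  unfolding kscheme_def scheme_def locally_ringed_space_def by blast

lemma k_hom_lrs_hom: "f \<in> k_hom k S T \<Longrightarrow> f \<in> lrs_hom (fst S) (fst T)"
  unfolding k_hom_def by blast

lemma k_id_in_k_hom:
  assumes S: "kscheme k S"
  shows "k_id S \<in> k_hom k S S"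
proof -
  have "snd S \<in> lrs_hom (fst S) (Spec k)"
    using S unfolding kscheme_def by blast
  then have "rs_comp (fst S) (fst S) (Spec k) (snd S) (k_id S) = snd S"
    unfolding k_id_def by (rule rs_comp_id_right)
  moreover have "k_id S \<in> lrs_hom (fst S) (fst S)"
    unfolding k_id_def by (rule rs_id_in_lrs_hom[OF kscheme_ringed_space[OF S]])
  ultimately show ?thesis
    unfolding k_hom_def by blast
qed

text \<open>Compatibility with the structure morphisms to \<open>Spec k\<close> is a case of associativity.\<close>

lemma k_comp_in_k_hom:
  assumes S: "kscheme k S" and T: "kscheme k T" and U: "kscheme k U"
    and f: "f \<in> k_hom k S T" and g: "g \<in> k_hom k T U"
  shows "k_comp S T U g f \<in> k_hom k S U"
proof -
  have fS: "rs_comp (fst S) (fst T) (Spec k) (snd T) f = snd S"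
    using f unfolding k_hom_def by blast
  have gT: "rs_comp (fst T) (fst U) (Spec k) (snd U) g = snd T"
    using g unfolding k_hom_def by blast
  have "snd U \<in> lrs_hom (fst U) (Spec k)"
    using U unfolding kscheme_def by blast
  from rs_comp_assoc[OF k_hom_lrs_hom[OF f] k_hom_lrs_hom[OF g] this]
  have "rs_comp (fst S) (fst U) (Spec k) (snd U) (k_comp S T U g f) = snd S"
    unfolding k_comp_def gT fS .
  moreover have "k_comp S T U g f \<in> lrs_hom (fst S) (fst U)"
    unfolding k_comp_def
    by (rule rs_comp_in_lrs_hom[OF kscheme_ringed_space[OF S] kscheme_ringed_space[OF T]
          kscheme_ringed_space[OF U] k_hom_lrs_hom[OF f] k_hom_lrs_hom[OF g]])
  ultimately show ?thesis
    unfolding k_hom_def by blast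
qed

lemma k_comp_assoc:
  assumes "f \<in> k_hom k S T" and "g \<in> k_hom k T U" and "h \<in> k_hom k U V"
  shows "k_comp S U V h (k_comp S T U g f) = k_comp S T V (k_comp T U V h g) f"
  using assms[THEN k_hom_lrs_hom] unfolding k_comp_def by (rule rs_comp_assoc)

lemma k_comp_id_left: "f \<in> k_hom k S T \<Longrightarrow> k_comp S T T (k_id T) f = f"
  unfolding k_comp_def k_id_def by (rule rs_comp_id_left[OF k_hom_lrs_hom])

lemma k_comp_id_right: "f \<in> k_hom k S T \<Longrightarrow> k_comp S S T f (k_id S) = f"
  unfolding k_comp_def k_id_def by (rule rs_comp_id_right[OF k_hom_lrs_hom])

section \<open>Presheaves\<close>

lemma presheaf_pb_closed:
  "presheaf k F \<Longrightarrow> kscheme k S \<Longrightarrow> kscheme k T \<Longrightarrow> f \<in> k_hom k S T \<Longrightarrow> z \<in> pt F T \<Longrightarrow>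
    pb F S T f z \<in> pt F S"
  unfolding presheaf_def by blast

lemma presheaf_pb_id:
  "presheaf k F \<Longrightarrow> kscheme k S \<Longrightarrow> z \<in> pt F S \<Longrightarrow> pb F S S (k_id S) z = z"
  unfolding presheaf_def by blast

lemma presheaf_pb_comp:
  "presheaf k F \<Longrightarrow> kscheme k S \<Longrightarrow> kscheme k T \<Longrightarrow> kscheme k U \<Longrightarrow> f \<in> k_hom k S T \<Longrightarrow>
    g \<in> k_hom k T U \<Longrightarrow> z \<in> pt F U \<Longrightarrow>
    pb F S U (k_comp S T U g f) z = pb F S T f (pb F T U g z)"
  unfolding presheaf_def by blast

lemma presheafI:
  assumes "\<And>S T f z. kscheme k S \<Longrightarrow> kscheme k T \<Longrightarrow> f \<in> k_hom k S T \<Longrightarrow> z \<in> pt F T \<Longrightarrow>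
      pb F S T f z \<in> pt F S"
    and "\<And>S z. kscheme k S \<Longrightarrow> z \<in> pt F S \<Longrightarrow> pb F S S (k_id S) z = z"
    and "\<And>S T U f g z. kscheme k S \<Longrightarrow> kscheme k T \<Longrightarrow> kscheme k U \<Longrightarrow> f \<in> k_hom k S T \<Longrightarrow>
      g \<in> k_hom k T U \<Longrightarrow> z \<in> pt F U \<Longrightarrow>
      pb F S U (k_comp S T U g f) z = pb F S T f (pb F T U g z)"
  shows "presheaf k F"
  unfolding presheaf_def using assms by simp

lemma presheaf_psh_prod:
  assumes "presheaf k F" and "presheaf k G"
  shows "presheaf k (psh_prod F G)"
  using assms unfolding presheaf_def psh_prod_def by (auto 0 3 simp: Pi_iff)

lemma presheaf_psh_sub:
  assumes F: "presheaf k F"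
    and sub: "\<And>S. kscheme k S \<Longrightarrow> P S \<subseteq> pt F S"
    and closed: "\<And>S T f z. kscheme k S \<Longrightarrow> kscheme k T \<Longrightarrow> f \<in> k_hom k S T \<Longrightarrow> z \<in> P T \<Longrightarrow>
      pb F S T f z \<in> P S"
  shows "presheaf k (psh_sub F P)"
  using assms unfolding presheaf_def psh_sub_def by (auto simp: subset_iff)

lemma global_sections_cring: "kscheme k S \<Longrightarrow> cring (global_sections S)"
  unfolding global_sections_def by (simp add: kscheme_ringed_space ringed_space_cring)

lemma pb_A1_ring_hom:
  assumes "f \<in> k_hom k S T"
  shows "pb A1 S T f \<in> ring_hom (global_sections T) (global_sections S)"
  using lrs_hom_ring_hom[OF k_hom_lrs_hom[OF assms] openin_topspace]
  unfolding rs_vimage_points[OF k_hom_lrs_hom[OF assms]] A1_def global_sections_def by simp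

lemma presheaf_A1: "presheaf k A1"
proof (rule presheafI)
  show "pb A1 S T f z \<in> pt A1 S" if "f \<in> k_hom k S T" "z \<in> pt A1 T" for S T f z
    using ring_hom_closed[OF pb_A1_ring_hom[OF that(1)]] that(2) by (simp add: A1_def)
  show "pb A1 S S (k_id S) z = z" if "z \<in> pt A1 S" for S z
    using that by (simp add: A1_def global_sections_def k_id_def rs_id_def)
  show "pb A1 S U (k_comp S T U g f) z = pb A1 S T f (pb A1 T U g z)"
    if "g \<in> k_hom k T U" "z \<in> pt A1 U" for S T U f g z
    using that(2) rs_vimage_points[OF k_hom_lrs_hom[OF that(1)]]
    by (simp add: A1_def global_sections_def k_comp_def rs_comp_def)
qed

lemma pt_Gm: "pt Gm S = Units (global_sections S)"
  and pb_Gm: "pb Gm = pb A1"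
  and pt_A1: "pt A1 S = carrier (global_sections S)"
  by (simp_all add: Gm_def psh_sub_def A1_def)

lemma ring_hom_Units:
  assumes "h \<in> ring_hom R S" and "x \<in> Units R"
  shows "h x \<in> Units S"
proof -
  from assms(2) obtain y where y: "y \<in> carrier R" "x \<in> carrier R"
    "y \<otimes>\<^bsub>R\<^esub> x = \<one>\<^bsub>R\<^esub>" "x \<otimes>\<^bsub>R\<^esub> y = \<one>\<^bsub>R\<^esub>"
    unfolding Units_def by blast
  then show ?thesis
    using ring_hom_closed[OF assms(1)] ring_hom_one[OF assms(1)]
      ring_hom_mult[OF assms(1), of x y] ring_hom_mult[OF assms(1), of y x]
    unfolding Units_def by auto
qed

lemma presheaf_Gm: "presheaf k Gm"
  unfolding Gm_def
proof (rule presheaf_psh_sub[OF presheaf_A1])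
  show "Units (global_sections S) \<subseteq> pt A1 S" for S
    unfolding pt_A1 Units_def by blast
  show "pb A1 S T f z \<in> Units (global_sections S)"
    if "f \<in> k_hom k S T" "z \<in> Units (global_sections T)" for S T f z
    using pb_A1_ring_hom[OF that(1)] that(2) by (rule ring_hom_Units)
qed

lemma nat_trans_closed:
  assumes "nat_trans k F G \<alpha>" and "kscheme k S" and "y \<in> pt F S"
  shows "\<alpha> S y \<in> pt G S"
  using assms unfolding nat_trans_def by blast

lemma nat_trans_natural:
  assumes "nat_trans k F G \<alpha>" and "kscheme k S" and "kscheme k T" and "f \<in> k_hom k S T"
    and "y \<in> pt F T"
  shows "\<alpha> S (pb F S T f y) = pb G S T f (\<alpha> T y)"
  using assms unfolding nat_trans_def by blast

lemma Gm_action_nat_trans: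
  "Gm_action k Z act \<Longrightarrow> nat_trans k (psh_prod Gm Z) Z (\<lambda>S (l, z). act S l z)"
  unfolding Gm_action_def by (rule conjunct1)

lemma Gm_action_closed:
  assumes "Gm_action k Z act" and "kscheme k S" and "l \<in> Units (global_sections S)" and "z \<in> pt Z S"
  shows "act S l z \<in> pt Z S"
  using nat_trans_closed[OF Gm_action_nat_trans[OF assms(1)] assms(2), of "(l, z)"] assms(3,4)
  by (simp add: psh_prod_def pt_Gm)

lemma Gm_action_pb:
  assumes "Gm_action k Z act" and "kscheme k S" and "kscheme k T" and "f \<in> k_hom k S T"
    and "l \<in> Units (global_sections T)" and "z \<in> pt Z T"
  shows "act S (pb A1 S T f l) (pb Z S T f z) = pb Z S T f (act T l z)"
  using nat_trans_natural[OF Gm_action_nat_trans[OF assms(1)] assms(2-4), of "(l, z)"] assms(5,6)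
  by (simp add: psh_prod_def pt_Gm pb_Gm)

lemma Gm_action_one:
  assumes "Gm_action k Z act" and "kscheme k S" and "z \<in> pt Z S"
  shows "act S \<one>\<^bsub>global_sections S\<^esub> z = z"
  using assms unfolding Gm_action_def by (simp del: split_paired_All)

lemma Gm_action_mult:
  assumes "Gm_action k Z act" and "kscheme k S" and "z \<in> pt Z S"
    and "l \<in> Units (global_sections S)" and "m \<in> Units (global_sections S)"
  shows "act S (l \<otimes>\<^bsub>global_sections S\<^esub> m) z = act S l (act S m z)"
  using assms unfolding Gm_action_def by (simp add: pt_Gm del: split_paired_All)

section \<open>Equivariant maps and base change\<close>

lemma XX_over_iff:
  "((x, y), g) \<in> pt (XX_over k S t) U \<longleftrightarrow>
    x \<in> carrier (global_sections U) \<and> y \<in> carrier (global_sections U) \<and> g \<in> k_hom k U S \<and>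
    x \<otimes>\<^bsub>global_sections U\<^esub> y = pb A1 U S g t"
  by (auto simp: XX_over_def fiber_prod_def psh_sub_def XX_def psh_prod_def pt_A1 yoneda_def
      XX_proj_def yoneda_map_def)

lemma pb_XX_over:
  "pb (XX_over k S t) U V h ((x, y), g) = ((pb A1 U V h x, pb A1 U V h y), k_comp U V S g h)"
  by (simp add: XX_over_def fiber_prod_def psh_sub_def XX_def psh_prod_def yoneda_def)

lemma equivariant_mapsI:
  assumes "\<And>U x y g. kscheme k U \<Longrightarrow> ((x, y), g) \<in> pt (XX_over k S t) U \<Longrightarrow>
      \<phi> U ((x, y), g) \<in> pt Z U"
    and "\<And>U V h x y g. kscheme k U \<Longrightarrow> kscheme k V \<Longrightarrow> h \<in> k_hom k U V \<Longrightarrow>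
      ((x, y), g) \<in> pt (XX_over k S t) V \<Longrightarrow>
      \<phi> U ((pb A1 U V h x, pb A1 U V h y), k_comp U V S g h) = pb Z U V h (\<phi> V ((x, y), g))"
    and "\<And>U l x y g. kscheme k U \<Longrightarrow> l \<in> Units (global_sections U) \<Longrightarrow>
      ((x, y), g) \<in> pt (XX_over k S t) U \<Longrightarrow>
      \<phi> U ((l \<otimes>\<^bsub>global_sections U\<^esub> x, inv\<^bsub>global_sections U\<^esub> l \<otimes>\<^bsub>global_sections U\<^esub> y), g)
        = act U l (\<phi> U ((x, y), g))"
    and "\<And>U x y g. \<not> (kscheme k U \<and> ((x, y), g) \<in> pt (XX_over k S t) U) \<Longrightarrow>
      \<phi> U ((x, y), g) = undefined"
  shows "\<phi> \<in> equivariant_maps k Z act S t"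
  using assms unfolding equivariant_maps_def psh_maps_def nat_trans_def
  by (simp add: pb_XX_over XX_act_def pt_Gm Pi_iff split_paired_all)

lemma equivariant_maps_nat_trans:
  "\<phi> \<in> equivariant_maps k Z act S t \<Longrightarrow> nat_trans k (XX_over k S t) Z \<phi>"
  unfolding equivariant_maps_def psh_maps_def by blast

lemma equivariant_maps_closed:
  assumes "\<phi> \<in> equivariant_maps k Z act S t" and "kscheme k U"
    and "p \<in> pt (XX_over k S t) U"
  shows "\<phi> U p \<in> pt Z U"
  by (rule nat_trans_closed[OF equivariant_maps_nat_trans[OF assms(1)] assms(2,3)])

lemma equivariant_maps_natural:
  assumes "\<phi> \<in> equivariant_maps k Z act S t" and "kscheme k U" and "kscheme k V"
    and "h \<in> k_hom k U V" and "((x, y), g) \<in> pt (XX_over k S t) V"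
  shows "\<phi> U ((pb A1 U V h x, pb A1 U V h y), k_comp U V S g h) = pb Z U V h (\<phi> V ((x, y), g))"
  using nat_trans_natural[OF equivariant_maps_nat_trans[OF assms(1)] assms(2-5)]
  unfolding pb_XX_over .

lemma equivariant_maps_act:
  assumes "\<phi> \<in> equivariant_maps k Z act S t" and "kscheme k U"
    and "l \<in> Units (global_sections U)" and "((x, y), g) \<in> pt (XX_over k S t) U"
  shows "\<phi> U ((l \<otimes>\<^bsub>global_sections U\<^esub> x, inv\<^bsub>global_sections U\<^esub> l \<otimes>\<^bsub>global_sections U\<^esub> y), g)
    = act U l (\<phi> U ((x, y), g))"
proof -
  have "\<forall>T. kscheme k T \<longrightarrow> (\<forall>l \<in> pt Gm T. \<forall>(x, g) \<in> pt (XX_over k S t) T.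
      \<phi> T (XX_act T l x, g) = act T l (\<phi> T (x, g)))"
    using assms(1) unfolding equivariant_maps_def by blast
  then have "\<forall>(x, g) \<in> pt (XX_over k S t) U. \<phi> U (XX_act U l x, g) = act U l (\<phi> U (x, g))"
    using assms(2,3) unfolding pt_Gm by blast
  from bspec[OF this assms(4)] show ?thesis
    by (simp add: XX_act_def)
qed

lemma equivariant_maps_undefined:
  assumes "\<phi> \<in> equivariant_maps k Z act S t" and "\<not> (kscheme k U \<and> p \<in> pt (XX_over k S t) U)"
  shows "\<phi> U p = undefined"
proof -
  have "\<forall>U p. \<not> (kscheme k U \<and> p \<in> pt (XX_over k S t) U) \<longrightarrow> \<phi> U p = undefined"
    using assms(1) unfolding equivariant_maps_def psh_maps_def mem_Collect_eq by (elim conjE)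
  then show ?thesis
    using assms(2) by (elim allE impE)
qed

lemma equivariant_maps_eqI:
  assumes "\<phi> \<in> equivariant_maps k Z act S t" and "\<psi> \<in> equivariant_maps k Z act S t"
    and "\<And>U x y g. kscheme k U \<Longrightarrow> ((x, y), g) \<in> pt (XX_over k S t) U \<Longrightarrow>
      \<phi> U ((x, y), g) = \<psi> U ((x, y), g)"
  shows "\<phi> = \<psi>"
proof (intro ext)
  fix U p
  show "\<phi> U p = \<psi> U p"
    using assms(3)[of U "fst (fst p)" "snd (fst p)" "snd p"]
      equivariant_maps_undefined[OF assms(1), of U p]
      equivariant_maps_undefined[OF assms(2), of U p]
    by (cases "kscheme k U \<and> p \<in> pt (XX_over k S t) U") auto
qed

text \<open>The second component of the pullback in \<open>Ztilde\<close>: the composite of \<open>\<phi>\<close> with the morphism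
  of fibre products from \<open>XX_over k S (f t)\<close> to \<open>XX_over k T t\<close> induced by \<open>f\<close>.\<close>

definition base_change ::
  "('k, 'm) ring_scheme \<Rightarrow> ('p, 'r, 'k) kscheme \<Rightarrow> ('p, 'r, 'k) kscheme \<Rightarrow> ('p, 'r) kmor \<Rightarrow> 'r
    \<Rightarrow> (('p, 'r, 'k) kscheme \<Rightarrow> ('r \<times> 'r) \<times> ('p, 'r) kmor \<Rightarrow> 'z)
    \<Rightarrow> (('p, 'r, 'k) kscheme \<Rightarrow> ('r \<times> 'r) \<times> ('p, 'r) kmor \<Rightarrow> 'z)" where
  "base_change k S T f t \<phi> = (\<lambda>U (x, g).
    if kscheme k U \<and> (x, g) \<in> pt (XX_over k S (pb A1 S T f t)) U
    then \<phi> U (x, k_comp U S T f g) else undefined)"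

lemma pt_Ztilde:
  "(t, \<phi>) \<in> pt (Ztilde k Z act) S \<longleftrightarrow>
    t \<in> carrier (global_sections S) \<and> \<phi> \<in> equivariant_maps k Z act S t"
  by (simp add: Ztilde_def pt_A1)

lemma pb_Ztilde:
  "pb (Ztilde k Z act) S T f (t, \<phi>) = (pb A1 S T f t, base_change k S T f t \<phi>)"
  by (simp add: Ztilde_def base_change_def)

lemma base_change_apply:
  assumes "kscheme k U" and "(x, g) \<in> pt (XX_over k S (pb A1 S T f t)) U"
  shows "base_change k S T f t \<phi> U (x, g) = \<phi> U (x, k_comp U S T f g)"
  using assms by (simp add: base_change_def)

lemma XX_over_base_change:
  assumes S: "kscheme k S" and T: "kscheme k T" and U: "kscheme k U"
    and f: "f \<in> k_hom k S T" and t: "t \<in> carrier (global_sections T)"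
    and p: "((x, y), g) \<in> pt (XX_over k S (pb A1 S T f t)) U"
  shows "((x, y), k_comp U S T f g) \<in> pt (XX_over k T t) U"
proof -
  have g: "g \<in> k_hom k U S"
    using p by (simp add: XX_over_iff)
  have "pb A1 U T (k_comp U S T f g) t = pb A1 U S g (pb A1 S T f t)"
    using t by (intro presheaf_pb_comp[OF presheaf_A1 U S T g f]) (simp add: pt_A1)
  then show ?thesis
    using p k_comp_in_k_hom[OF U S T g f] by (simp add: XX_over_iff)
qed

lemma XX_over_pb:
  assumes U: "kscheme k U" and V: "kscheme k V" and S: "kscheme k S"
    and h: "h \<in> k_hom k U V" and t: "t \<in> carrier (global_sections S)"
    and p: "((x, y), g) \<in> pt (XX_over k S t) V"
  shows "((pb A1 U V h x, pb A1 U V h y), k_comp U V S g h) \<in> pt (XX_over k S t) U"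
proof -
  note hom = pb_A1_ring_hom[OF h]
  have g: "g \<in> k_hom k V S" and x: "x \<in> carrier (global_sections V)"
    and y: "y \<in> carrier (global_sections V)"
    and xy: "x \<otimes>\<^bsub>global_sections V\<^esub> y = pb A1 V S g t"
    using p by (simp_all add: XX_over_iff)
  have "pb A1 U V h x \<otimes>\<^bsub>global_sections U\<^esub> pb A1 U V h y = pb A1 U V h (pb A1 V S g t)"
    using ring_hom_mult[OF hom x y] xy by simp
  also have "\<dots> = pb A1 U S (k_comp U V S g h) t"
    using t by (intro presheaf_pb_comp[OF presheaf_A1 U V S h g, symmetric]) (simp add: pt_A1)
  finally show ?thesis
    using ring_hom_closed[OF hom x] ring_hom_closed[OF hom y] k_comp_in_k_hom[OF U V S h g]
    by (simp add: XX_over_iff)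
qed

text \<open>The action preserves the fibres of \<open>XX\<close> over the affine line because
  \<open>(l x) (l\<inverse> y) = x y\<close>.\<close>

lemma XX_over_act:
  assumes U: "kscheme k U" and l: "l \<in> Units (global_sections U)"
    and p: "((x, y), g) \<in> pt (XX_over k S t) U"
  shows "((l \<otimes>\<^bsub>global_sections U\<^esub> x, inv\<^bsub>global_sections U\<^esub> l \<otimes>\<^bsub>global_sections U\<^esub> y), g)
    \<in> pt (XX_over k S t) U"
proof -
  interpret cring "global_sections U"
    by (rule global_sections_cring[OF U])
  let ?R = "global_sections U"
  have x: "x \<in> carrier ?R" and y: "y \<in> carrier ?R"
    using p by (simp_all add: XX_over_iff)
  have "(l \<otimes>\<^bsub>?R\<^esub> x) \<otimes>\<^bsub>?R\<^esub> (inv\<^bsub>?R\<^esub> l \<otimes>\<^bsub>?R\<^esub> y)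
      = (l \<otimes>\<^bsub>?R\<^esub> inv\<^bsub>?R\<^esub> l) \<otimes>\<^bsub>?R\<^esub> (x \<otimes>\<^bsub>?R\<^esub> y)"
    using l x y Units_closed[OF l] Units_inv_closed[OF l]
    by (simp only: m_ac m_closed)
  then show ?thesis
    using p l x y by (simp add: XX_over_iff Units_closed)
qed

lemma base_change_equivariant:
  assumes S: "kscheme k S" and T: "kscheme k T" and f: "f \<in> k_hom k S T"
    and t: "t \<in> carrier (global_sections T)" and \<phi>: "\<phi> \<in> equivariant_maps k Z act T t"
  shows "base_change k S T f t \<phi> \<in> equivariant_maps k Z act S (pb A1 S T f t)"
proof -
  have ft: "pb A1 S T f t \<in> carrier (global_sections S)"
    using ring_hom_closed[OF pb_A1_ring_hom[OF f] t] .
  note over = XX_over_base_change[OF S T _ f t]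
  show ?thesis
  proof (rule equivariant_mapsI)
    fix U x y g assume U: "kscheme k U" and p: "((x, y), g) \<in> pt (XX_over k S (pb A1 S T f t)) U"
    show "base_change k S T f t \<phi> U ((x, y), g) \<in> pt Z U"
      unfolding base_change_apply[OF U p] by (rule equivariant_maps_closed[OF \<phi> U over[OF U p]])
  next
    fix U V h x y g assume U: "kscheme k U" and V: "kscheme k V" and h: "h \<in> k_hom k U V"
      and p: "((x, y), g) \<in> pt (XX_over k S (pb A1 S T f t)) V"
    have g: "g \<in> k_hom k V S"
      using p by (simp add: XX_over_iff)
    show "base_change k S T f t \<phi> U ((pb A1 U V h x, pb A1 U V h y), k_comp U V S g h)
        = pb Z U V h (base_change k S T f t \<phi> V ((x, y), g))"
      unfolding base_change_apply[OF V p] base_change_apply[OF U XX_over_pb[OF U V S h ft p]]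
        k_comp_assoc[OF h g f]
      by (rule equivariant_maps_natural[OF \<phi> U V h over[OF V p]])
  next
    fix U l x y g assume U: "kscheme k U" and l: "l \<in> Units (global_sections U)"
      and p: "((x, y), g) \<in> pt (XX_over k S (pb A1 S T f t)) U"
    show "base_change k S T f t \<phi> U
        ((l \<otimes>\<^bsub>global_sections U\<^esub> x, inv\<^bsub>global_sections U\<^esub> l \<otimes>\<^bsub>global_sections U\<^esub> y), g)
        = act U l (base_change k S T f t \<phi> U ((x, y), g))"
      unfolding base_change_apply[OF U p] base_change_apply[OF U XX_over_act[OF U l p]]
      by (rule equivariant_maps_act[OF \<phi> U l over[OF U p]])
  next
    fix U x y g assume "\<not> (kscheme k U \<and> ((x, y), g) \<in> pt (XX_over k S (pb A1 S T f t)) U)"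
    then show "base_change k S T f t \<phi> U ((x, y), g) = undefined"
      unfolding base_change_def by (simp only: split if_False)
  qed
qed

text \<open>The two functor laws reduce to the unit law and to associativity of \<open>k_comp\<close>, since base change
  only precomposes the structure morphism \<open>U \<rightarrow> S\<close> with \<open>f\<close>.\<close>

lemma presheaf_Ztilde:
  fixes k :: "('k, 'm) ring_scheme" and Z :: "('p, 'r, 'k, 'z) presheaf"
  shows "presheaf k (Ztilde k Z act)"
proof (rule presheafI)
  fix S T :: "('p, 'r, 'k) kscheme" and f \<zeta>
  assume S: "kscheme k S" and T: "kscheme k T" and f: "f \<in> k_hom k S T"
    and \<zeta>: "\<zeta> \<in> pt (Ztilde k Z act) T"
  then show "pb (Ztilde k Z act) S T f \<zeta> \<in> pt (Ztilde k Z act) S"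
    using ring_hom_closed[OF pb_A1_ring_hom[OF f]] base_change_equivariant[OF S T f]
    by (cases \<zeta>) (auto simp: pt_Ztilde pb_Ztilde)
next
  fix S :: "('p, 'r, 'k) kscheme" and \<zeta>
  assume S: "kscheme k S" and "\<zeta> \<in> pt (Ztilde k Z act) S"
  then obtain t \<phi> where \<zeta>: "\<zeta> = (t, \<phi>)" and t: "t \<in> carrier (global_sections S)"
    and \<phi>: "\<phi> \<in> equivariant_maps k Z act S t"
    by (cases \<zeta>) (simp add: pt_Ztilde)
  note id = k_id_in_k_hom[OF S]
  have idt: "pb A1 S S (k_id S) t = t"
    using t by (intro presheaf_pb_id[OF presheaf_A1 S]) (simp add: pt_A1)
  have "base_change k S S (k_id S) t \<phi> = \<phi>"
  proof (rule equivariant_maps_eqI[OF _ \<phi>])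
    show "base_change k S S (k_id S) t \<phi> \<in> equivariant_maps k Z act S t"
      using base_change_equivariant[OF S S id t \<phi>] by (simp only: idt)
    fix U x y g assume U: "kscheme k U" and p: "((x, y), g) \<in> pt (XX_over k S t) U"
    have "g \<in> k_hom k U S"
      using p by (simp add: XX_over_iff)
    then show "base_change k S S (k_id S) t \<phi> U ((x, y), g) = \<phi> U ((x, y), g)"
      using base_change_apply[OF U, of "(x, y)" g S S "k_id S" t \<phi>] p
      by (simp add: idt k_comp_id_left)
  qed
  then show "pb (Ztilde k Z act) S S (k_id S) \<zeta> = \<zeta>"
    by (simp add: \<zeta> pb_Ztilde idt)
next
  fix S T V :: "('p, 'r, 'k) kscheme" and f g \<zeta>
  assume S: "kscheme k S" and T: "kscheme k T" and V: "kscheme k V"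
    and f: "f \<in> k_hom k S T" and g: "g \<in> k_hom k T V" and "\<zeta> \<in> pt (Ztilde k Z act) V"
  then obtain t \<phi> where \<zeta>: "\<zeta> = (t, \<phi>)" and t: "t \<in> carrier (global_sections V)"
    and \<phi>: "\<phi> \<in> equivariant_maps k Z act V t"
    by (cases \<zeta>) (simp add: pt_Ztilde)
  note gf = k_comp_in_k_hom[OF S T V f g]
  have gt: "pb A1 T V g t \<in> carrier (global_sections T)"
    using ring_hom_closed[OF pb_A1_ring_hom[OF g] t] .
  have gft: "pb A1 S V (k_comp S T V g f) t = pb A1 S T f (pb A1 T V g t)"
    using t by (intro presheaf_pb_comp[OF presheaf_A1 S T V f g]) (simp add: pt_A1)
  have "base_change k S V (k_comp S T V g f) t \<phi>
      = base_change k S T f (pb A1 T V g t) (base_change k T V g t \<phi>)"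
  proof (rule equivariant_maps_eqI)
    show "base_change k S V (k_comp S T V g f) t \<phi>
        \<in> equivariant_maps k Z act S (pb A1 S V (k_comp S T V g f) t)"
      by (rule base_change_equivariant[OF S V gf t \<phi>])
    show "base_change k S T f (pb A1 T V g t) (base_change k T V g t \<phi>)
        \<in> equivariant_maps k Z act S (pb A1 S V (k_comp S T V g f) t)"
      unfolding gft
      by (rule base_change_equivariant[OF S T f gt base_change_equivariant[OF T V g t \<phi>]])
    fix U x y h assume U: "kscheme k U"
      and p: "((x, y), h) \<in> pt (XX_over k S (pb A1 S V (k_comp S T V g f) t)) U"
    have p': "((x, y), h) \<in> pt (XX_over k S (pb A1 S T f (pb A1 T V g t))) U"
      using p by (simp only: gft)
    have h: "h \<in> k_hom k U S"
      using p by (simp add: XX_over_iff)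
    show "base_change k S V (k_comp S T V g f) t \<phi> U ((x, y), h)
        = base_change k S T f (pb A1 T V g t) (base_change k T V g t \<phi>) U ((x, y), h)"
      unfolding base_change_apply[OF U p] base_change_apply[OF U p']
        base_change_apply[OF U XX_over_base_change[OF S T U f gt p']] k_comp_assoc[OF h f g]
      by (rule refl)
  qed
  then show "pb (Ztilde k Z act) S V (k_comp S T V g f) \<zeta>
      = pb (Ztilde k Z act) S T f (pb (Ztilde k Z act) T V g \<zeta>)"
    by (simp add: \<zeta> pb_Ztilde gft)
qed

lemma presheaf_Ztilde_over_Gm:
  fixes k :: "('k, 'm) ring_scheme" and Z :: "('p, 'r, 'k, 'z) presheaf"
  shows "presheaf k (Ztilde_over_Gm k Z act)"
  unfolding Ztilde_over_Gm_def
proof (rule presheaf_psh_sub[OF presheaf_Ztilde])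
  fix S T :: "('p, 'r, 'k) kscheme" and f \<zeta>
  assume S: "kscheme k S" and T: "kscheme k T" and f: "f \<in> k_hom k S T"
    and \<zeta>: "\<zeta> \<in> {\<zeta> \<in> pt (Ztilde k Z act) T. fst \<zeta> \<in> pt Gm T}"
  then have "pb (Ztilde k Z act) S T f \<zeta> \<in> pt (Ztilde k Z act) S"
    by (intro presheaf_pb_closed[OF presheaf_Ztilde S T f]) simp
  moreover have "fst (pb (Ztilde k Z act) S T f \<zeta>) \<in> pt Gm S"
    using presheaf_pb_closed[OF presheaf_Gm S T f, of "fst \<zeta>"] \<zeta>
    by (cases \<zeta>) (simp add: pb_Ztilde pb_Gm)
  ultimately show "pb (Ztilde k Z act) S T f \<zeta>
      \<in> {\<zeta> \<in> pt (Ztilde k Z act) S. fst \<zeta> \<in> pt Gm S}"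
    by simp
qed simp

lemma presheaf_action_graph:
  assumes Z: "presheaf k Z" and act: "Gm_action k Z act"
  shows "presheaf k (action_graph Z act)"
  unfolding action_graph_def
proof (rule presheaf_psh_sub)
  show "presheaf k (psh_prod Gm (psh_prod Z Z))"
    by (intro presheaf_psh_prod presheaf_Gm Z)
  show "pb (psh_prod Gm (psh_prod Z Z)) S T f w
      \<in> {(t, z1, z2). t \<in> pt Gm S \<and> z1 \<in> pt Z S \<and> z2 \<in> pt Z S \<and> act S t z1 = z2}"
    if S: "kscheme k S" and T: "kscheme k T" and f: "f \<in> k_hom k S T"
      and w: "w \<in> {(t, z1, z2). t \<in> pt Gm T \<and> z1 \<in> pt Z T \<and> z2 \<in> pt Z T \<and> act T t z1 = z2}"
    for S T f w
    using w presheaf_pb_closed[OF presheaf_Gm S T f] presheaf_pb_closed[OF Z S T f]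
      Gm_action_pb[OF act S T f]
    by (auto simp: psh_prod_def pt_Gm pb_Gm)
qed (auto simp: psh_prod_def)

section \<open>The two evaluations\<close>

lemma XX_over_id:
  assumes S: "kscheme k S" and "x \<in> carrier (global_sections S)"
    and "y \<in> carrier (global_sections S)" and t: "x \<otimes>\<^bsub>global_sections S\<^esub> y = t"
  shows "((x, y), k_id S) \<in> pt (XX_over k S t) S"
proof -
  interpret cring "global_sections S"
    by (rule global_sections_cring[OF S])
  have "pb A1 S S (k_id S) t = t"
    using assms(2,3) unfolding t[symmetric]
    by (intro presheaf_pb_id[OF presheaf_A1 S]) (simp add: pt_A1)
  then show ?thesis
    using assms k_id_in_k_hom[OF S] by (simp add: XX_over_iff)
qed

text \<open>The Yoneda lemma for sections of \<open>XX_over k T t\<close>: the value of \<open>\<phi>\<close> at the universal point,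
  lying over the identity of \<open>T\<close>, determines its values at the pullbacks of that point.\<close>

lemma equivariant_maps_eval:
  assumes S: "kscheme k S" and T: "kscheme k T" and f: "f \<in> k_hom k S T"
    and \<phi>: "\<phi> \<in> equivariant_maps k Z act T t"
    and p: "((x, y), k_id T) \<in> pt (XX_over k T t) T"
  shows "\<phi> S ((pb A1 S T f x, pb A1 S T f y), f) = pb Z S T f (\<phi> T ((x, y), k_id T))"
  using equivariant_maps_natural[OF \<phi> S T f p] by (simp only: k_comp_id_left[OF f])

text \<open>Evaluation at a section \<open>(x, y)\<close> commutes with base change. For \<open>(1, t)\<close> and \<open>(t, 1)\<close> this is
  the naturality of \<open>pi1\<close> and \<open>pi2\<close>.\<close>

lemma base_change_eval:
  assumes S: "kscheme k S" and T: "kscheme k T" and f: "f \<in> k_hom k S T"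
    and \<phi>: "\<phi> \<in> equivariant_maps k Z act T t"
    and x: "x \<in> carrier (global_sections T)" and y: "y \<in> carrier (global_sections T)"
    and t: "x \<otimes>\<^bsub>global_sections T\<^esub> y = t"
  shows "base_change k S T f t \<phi> S ((pb A1 S T f x, pb A1 S T f y), k_id S)
    = pb Z S T f (\<phi> T ((x, y), k_id T))"
proof -
  note hom = pb_A1_ring_hom[OF f]
  have "((pb A1 S T f x, pb A1 S T f y), k_id S) \<in> pt (XX_over k S (pb A1 S T f t)) S"
    using ring_hom_closed[OF hom x] ring_hom_closed[OF hom y] ring_hom_mult[OF hom x y] t
    by (intro XX_over_id[OF S]) simp_all
  then show ?thesis
    using equivariant_maps_eval[OF S T f \<phi> XX_over_id[OF T x y t]]
    by (simp only: base_change_apply[OF S] k_comp_id_right[OF f])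
qed

lemma ptilde_Pair:
  "ptilde S (t, \<phi>) = (t, \<phi> S ((\<one>\<^bsub>global_sections S\<^esub>, t), k_id S),
    \<phi> S ((t, \<one>\<^bsub>global_sections S\<^esub>), k_id S))"
  by (simp add: ptilde_def pi1_def pi2_def section_pullback_def)

lemma XX_over_unit_sections:
  assumes S: "kscheme k S" and t: "t \<in> carrier (global_sections S)"
  shows "((\<one>\<^bsub>global_sections S\<^esub>, t), k_id S) \<in> pt (XX_over k S t) S"
    and "((t, \<one>\<^bsub>global_sections S\<^esub>), k_id S) \<in> pt (XX_over k S t) S"
proof -
  interpret cring "global_sections S"
    by (rule global_sections_cring[OF S])
  show "((\<one>\<^bsub>global_sections S\<^esub>, t), k_id S) \<in> pt (XX_over k S t) S"
    and "((t, \<one>\<^bsub>global_sections S\<^esub>), k_id S) \<in> pt (XX_over k S t) S"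
    using t by (intro XX_over_id[OF S]; simp)+
qed

lemma ptilde_closed:
  assumes S: "kscheme k S" and \<zeta>: "\<zeta> \<in> pt (Ztilde k Z act) S"
  shows "ptilde S \<zeta> \<in> pt (psh_prod A1 (psh_prod Z Z)) S"
proof -
  obtain t \<phi> where "\<zeta> = (t, \<phi>)" "t \<in> carrier (global_sections S)"
    "\<phi> \<in> equivariant_maps k Z act S t"
    using \<zeta> by (cases \<zeta>) (simp add: pt_Ztilde)
  then show ?thesis
    using XX_over_unit_sections[OF S] by (simp add: ptilde_Pair psh_prod_def pt_A1 equivariant_maps_closed[OF _ S])
qed

lemma ptilde_pb:
  assumes S: "kscheme k S" and T: "kscheme k T" and f: "f \<in> k_hom k S T"
    and "\<zeta> \<in> pt (Ztilde k Z act) T"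
  shows "ptilde S (pb (Ztilde k Z act) S T f \<zeta>) = pb (psh_prod A1 (psh_prod Z Z)) S T f (ptilde T \<zeta>)"
proof -
  obtain t \<phi> where \<zeta>: "\<zeta> = (t, \<phi>)" and t: "t \<in> carrier (global_sections T)"
    and \<phi>: "\<phi> \<in> equivariant_maps k Z act T t"
    using assms(4) by (cases \<zeta>) (simp add: pt_Ztilde)
  interpret cring "global_sections T"
    by (rule global_sections_cring[OF T])
  note eval = base_change_eval[OF S T f \<phi>]
  show ?thesis
    using eval[of "\<one>\<^bsub>global_sections T\<^esub>" t] eval[of t "\<one>\<^bsub>global_sections T\<^esub>"] t
      ring_hom_one[OF pb_A1_ring_hom[OF f]]
    by (simp add: \<zeta> pb_Ztilde ptilde_Pair psh_prod_def)
qed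

lemma nat_trans_ptilde: "nat_trans k (Ztilde k Z act) (psh_prod A1 (psh_prod Z Z)) ptilde"
  unfolding nat_trans_def using ptilde_closed ptilde_pb by blast

section \<open>The fibres over invertible parameters\<close>

text \<open>A factor of a unit is a unit, and \<open>x y\<close> is the pullback of the unit \<open>t\<close>. This is where
  invertibility of the parameter enters the construction of the inverse.\<close>

lemma XX_over_fst_unit:
  assumes U: "kscheme k U" and t: "t \<in> Units (global_sections S)"
    and p: "((x, y), g) \<in> pt (XX_over k S t) U"
  shows "x \<in> Units (global_sections U)"
proof -
  interpret cring "global_sections U"
    by (rule global_sections_cring[OF U])
  have g: "g \<in> k_hom k U S"
    using p by (simp add: XX_over_iff)
  have "pb A1 U S g t \<in> Units (global_sections U)"
    by (rule ring_hom_Units[OF pb_A1_ring_hom[OF g] t])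
  then show ?thesis
    using p by (intro unit_factor[of x y]) (simp_all add: XX_over_iff)
qed

text \<open>The element \<open>t\<close> of \<open>Gm\<close> carries \<open>(1, t)\<close> to \<open>(t 1, t\<inverse> t) = (t, 1)\<close>.\<close>

lemma act_pi1_eq_pi2:
  assumes S: "kscheme k S" and t: "t \<in> Units (global_sections S)"
    and \<phi>: "\<phi> \<in> equivariant_maps k Z act S t"
  shows "act S t (\<phi> S ((\<one>\<^bsub>global_sections S\<^esub>, t), k_id S))
    = \<phi> S ((t, \<one>\<^bsub>global_sections S\<^esub>), k_id S)"
proof -
  interpret cring "global_sections S"
    by (rule global_sections_cring[OF S])
  show ?thesis
    using equivariant_maps_act[OF \<phi> S t XX_over_unit_sections(1)[OF S Units_closed[OF t]]] t
    by (simp add: Units_closed)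
qed

text \<open>The equivariant map on the hyperbola \<open>x y = t\<close> with value \<open>z\<close> at the base point \<open>(1, t)\<close>, for
  invertible \<open>t\<close>. The coordinate \<open>x\<close> is the element of \<open>Gm\<close> that carries the base point
  to \<open>(x, y)\<close>.\<close>

definition orbit_map ::
  "('k, 'm) ring_scheme \<Rightarrow> ('p, 'r, 'k, 'z) presheaf
    \<Rightarrow> (('p, 'r, 'k) kscheme \<Rightarrow> 'r \<Rightarrow> 'z \<Rightarrow> 'z) \<Rightarrow> ('p, 'r, 'k) kscheme \<Rightarrow> 'r \<Rightarrow> 'z
    \<Rightarrow> ('p, 'r, 'k) kscheme \<Rightarrow> ('r \<times> 'r) \<times> ('p, 'r) kmor \<Rightarrow> 'z" where
  "orbit_map k Z act S t z = (\<lambda>U ((x, y), g).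
    if kscheme k U \<and> ((x, y), g) \<in> pt (XX_over k S t) U
    then act U x (pb Z U S g z) else undefined)"

lemma orbit_map_apply:
  assumes "kscheme k U" and "((x, y), g) \<in> pt (XX_over k S t) U"
  shows "orbit_map k Z act S t z U ((x, y), g) = act U x (pb Z U S g z)"
  using assms by (simp add: orbit_map_def)

lemma orbit_map_equivariant:
  assumes Z: "presheaf k Z" and act: "Gm_action k Z act"
    and S: "kscheme k S" and t: "t \<in> Units (global_sections S)" and z: "z \<in> pt Z S"
  shows "orbit_map k Z act S t z \<in> equivariant_maps k Z act S t"
proof -
  have tc: "t \<in> carrier (global_sections S)"
    using t unfolding Units_def by blast
  show ?thesis
  proof (rule equivariant_mapsI)
    fix U x y g assume U: "kscheme k U" and p: "((x, y), g) \<in> pt (XX_over k S t) U"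
    have g: "g \<in> k_hom k U S"
      using p by (simp add: XX_over_iff)
    show "orbit_map k Z act S t z U ((x, y), g) \<in> pt Z U"
      unfolding orbit_map_apply[OF U p]
      by (rule Gm_action_closed[OF act U XX_over_fst_unit[OF U t p]
            presheaf_pb_closed[OF Z U S g z]])
  next
    fix U V h x y g assume U: "kscheme k U" and V: "kscheme k V" and h: "h \<in> k_hom k U V"
      and p: "((x, y), g) \<in> pt (XX_over k S t) V"
    have g: "g \<in> k_hom k V S"
      using p by (simp add: XX_over_iff)
    show "orbit_map k Z act S t z U ((pb A1 U V h x, pb A1 U V h y), k_comp U V S g h)
        = pb Z U V h (orbit_map k Z act S t z V ((x, y), g))"
      unfolding orbit_map_apply[OF V p] orbit_map_apply[OF U XX_over_pb[OF U V S h tc p]]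
        presheaf_pb_comp[OF Z U V S h g z]
      by (rule Gm_action_pb[OF act U V h XX_over_fst_unit[OF V t p]
            presheaf_pb_closed[OF Z V S g z]])
  next
    fix U l x y g assume U: "kscheme k U" and l: "l \<in> Units (global_sections U)"
      and p: "((x, y), g) \<in> pt (XX_over k S t) U"
    have g: "g \<in> k_hom k U S"
      using p by (simp add: XX_over_iff)
    show "orbit_map k Z act S t z U
        ((l \<otimes>\<^bsub>global_sections U\<^esub> x, inv\<^bsub>global_sections U\<^esub> l \<otimes>\<^bsub>global_sections U\<^esub> y), g)
        = act U l (orbit_map k Z act S t z U ((x, y), g))"
      unfolding orbit_map_apply[OF U p] orbit_map_apply[OF U XX_over_act[OF U l p]]
      by (rule Gm_action_mult[OF act U presheaf_pb_closed[OF Z U S g z] l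
            XX_over_fst_unit[OF U t p]])
  next
    fix U x y g assume "\<not> (kscheme k U \<and> ((x, y), g) \<in> pt (XX_over k S t) U)"
    then show "orbit_map k Z act S t z U ((x, y), g) = undefined"
      unfolding orbit_map_def by (simp only: split if_False)
  qed
qed

text \<open>Every point \<open>(x, y)\<close> is \<open>x (1, x y)\<close>, and \<open>(1, x y)\<close> is the pullback of the base point \<open>(1, t)\<close>
  along the structure morphism \<open>g\<close>. So equivariance and naturality leave no choice for the value
  of \<open>\<phi>\<close> at \<open>(x, y)\<close>.\<close>

lemma equivariant_maps_eq_orbit_map:
  assumes Z: "presheaf k Z" and act: "Gm_action k Z act"
    and S: "kscheme k S" and t: "t \<in> Units (global_sections S)"
    and \<phi>: "\<phi> \<in> equivariant_maps k Z act S t"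
  shows "orbit_map k Z act S t (\<phi> S ((\<one>\<^bsub>global_sections S\<^esub>, t), k_id S)) = \<phi>"
proof -
  have tc: "t \<in> carrier (global_sections S)"
    using t unfolding Units_def by blast
  note base = XX_over_unit_sections(1)[OF S tc]
  note z = equivariant_maps_closed[OF \<phi> S base]
  show ?thesis
  proof (rule equivariant_maps_eqI[OF orbit_map_equivariant[OF Z act S t z] \<phi>])
    fix U x y g assume U: "kscheme k U" and p: "((x, y), g) \<in> pt (XX_over k S t) U"
    let ?R = "global_sections U"
    interpret cring ?R
      by (rule global_sections_cring[OF U])
    have g: "g \<in> k_hom k U S" and y: "y \<in> carrier ?R" and xy: "x \<otimes>\<^bsub>?R\<^esub> y = pb A1 U S g t"
      using p by (simp_all add: XX_over_iff)
    have x: "x \<in> Units ?R"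
      by (rule XX_over_fst_unit[OF U t p])
    have one: "pb A1 U S g \<one>\<^bsub>global_sections S\<^esub> = \<one>\<^bsub>?R\<^esub>"
      by (rule ring_hom_one[OF pb_A1_ring_hom[OF g]])
    have "((\<one>\<^bsub>?R\<^esub>, x \<otimes>\<^bsub>?R\<^esub> y), g) \<in> pt (XX_over k S t) U"
      using g x y m_closed[OF Units_closed[OF x] y] unfolding XX_over_iff xy[symmetric]
      by simp
    from equivariant_maps_act[OF \<phi> U x this]
    have "\<phi> U ((x, y), g) = act U x (\<phi> U ((\<one>\<^bsub>?R\<^esub>, x \<otimes>\<^bsub>?R\<^esub> y), g))"
      using x y by (simp add: Units_closed m_assoc[symmetric])
    also have "\<dots> = act U x (pb Z U S g (\<phi> S ((\<one>\<^bsub>global_sections S\<^esub>, t), k_id S)))"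
      using equivariant_maps_eval[OF U S g \<phi> base] by (simp only: xy one)
    finally show "orbit_map k Z act S t (\<phi> S ((\<one>\<^bsub>global_sections S\<^esub>, t), k_id S)) U ((x, y), g)
        = \<phi> U ((x, y), g)"
      unfolding orbit_map_apply[OF U p] by (rule sym)
  qed
qed

text \<open>Both sides send \<open>((x, y), g)\<close> to \<open>x\<close> acting on the pullback of \<open>z\<close> along the composite of \<open>g\<close>
  and \<open>f\<close>.\<close>

lemma orbit_map_base_change:
  assumes Z: "presheaf k Z" and act: "Gm_action k Z act"
    and S: "kscheme k S" and T: "kscheme k T" and f: "f \<in> k_hom k S T"
    and t: "t \<in> Units (global_sections T)" and z: "z \<in> pt Z T"
  shows "base_change k S T f t (orbit_map k Z act T t z)
    = orbit_map k Z act S (pb A1 S T f t) (pb Z S T f z)"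
proof -
  have tc: "t \<in> carrier (global_sections T)"
    using t unfolding Units_def by blast
  have ft: "pb A1 S T f t \<in> Units (global_sections S)"
    by (rule ring_hom_Units[OF pb_A1_ring_hom[OF f] t])
  show ?thesis
  proof (rule equivariant_maps_eqI)
    show "base_change k S T f t (orbit_map k Z act T t z)
        \<in> equivariant_maps k Z act S (pb A1 S T f t)"
      by (rule base_change_equivariant[OF S T f tc orbit_map_equivariant[OF Z act T t z]])
    show "orbit_map k Z act S (pb A1 S T f t) (pb Z S T f z)
        \<in> equivariant_maps k Z act S (pb A1 S T f t)"
      by (rule orbit_map_equivariant[OF Z act S ft presheaf_pb_closed[OF Z S T f z]])
    fix U x y g assume U: "kscheme k U" and p: "((x, y), g) \<in> pt (XX_over k S (pb A1 S T f t)) U"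
    have g: "g \<in> k_hom k U S"
      using p by (simp add: XX_over_iff)
    show "base_change k S T f t (orbit_map k Z act T t z) U ((x, y), g)
        = orbit_map k Z act S (pb A1 S T f t) (pb Z S T f z) U ((x, y), g)"
      unfolding base_change_apply[OF U p] orbit_map_apply[OF U p]
        orbit_map_apply[OF U XX_over_base_change[OF S T U f tc p]]
        presheaf_pb_comp[OF Z U S T g f z]
      by (rule refl)
  qed
qed

lemma pt_Ztilde_over_Gm:
  "(t, \<phi>) \<in> pt (Ztilde_over_Gm k Z act) S \<longleftrightarrow>
    t \<in> Units (global_sections S) \<and> \<phi> \<in> equivariant_maps k Z act S t"
  unfolding Ztilde_over_Gm_def by (auto simp: psh_sub_def pt_Ztilde pt_Gm Units_def)

lemma pb_Ztilde_over_Gm: "pb (Ztilde_over_Gm k Z act) = pb (Ztilde k Z act)"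
  by (simp add: Ztilde_over_Gm_def psh_sub_def)

lemma pt_action_graph:
  "(t, z1, z2) \<in> pt (action_graph Z act) S \<longleftrightarrow>
    t \<in> Units (global_sections S) \<and> z1 \<in> pt Z S \<and> z2 \<in> pt Z S \<and> act S t z1 = z2"
  by (simp add: action_graph_def psh_sub_def pt_Gm)

lemma pb_action_graph: "pb (action_graph Z act) = pb (psh_prod A1 (psh_prod Z Z))"
  by (simp add: action_graph_def psh_sub_def psh_prod_def pb_Gm)

lemma pb_action_graph_apply:
  "pb (action_graph Z act) S T f (t, z1, z2) = (pb A1 S T f t, pb Z S T f z1, pb Z S T f z2)"
  by (simp add: pb_action_graph psh_prod_def)

lemma ptilde_in_action_graph:
  assumes S: "kscheme k S" and "\<zeta> \<in> pt (Ztilde_over_Gm k Z act) S"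
  shows "ptilde S \<zeta> \<in> pt (action_graph Z act) S"
proof -
  obtain t \<phi> where \<zeta>: "\<zeta> = (t, \<phi>)" and t: "t \<in> Units (global_sections S)"
    and \<phi>: "\<phi> \<in> equivariant_maps k Z act S t"
    using assms(2) by (cases \<zeta>) (simp add: pt_Ztilde_over_Gm)
  have tc: "t \<in> carrier (global_sections S)"
    using t unfolding Units_def by blast
  show ?thesis
    using t act_pi1_eq_pi2[OF S t \<phi>] equivariant_maps_closed[OF \<phi> S] XX_over_unit_sections[OF S tc]
    by (simp add: \<zeta> ptilde_Pair pt_action_graph)
qed

lemma ptilde_orbit_map:
  assumes Z: "presheaf k Z" and act: "Gm_action k Z act" and S: "kscheme k S"
    and w: "(t, z1, z2) \<in> pt (action_graph Z act) S"
  shows "ptilde S (t, orbit_map k Z act S t z1) = (t, z1, z2)"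
proof -
  have t: "t \<in> Units (global_sections S)" and z1: "z1 \<in> pt Z S" and z2: "act S t z1 = z2"
    using w by (simp_all add: pt_action_graph)
  have tc: "t \<in> carrier (global_sections S)"
    using t unfolding Units_def by blast
  show ?thesis
    using orbit_map_apply[OF S XX_over_unit_sections(1)[OF S tc], of Z act z1]
      orbit_map_apply[OF S XX_over_unit_sections(2)[OF S tc], of Z act z1]
    by (simp add: ptilde_Pair presheaf_pb_id[OF Z S z1] Gm_action_one[OF act S z1] z2)
qed

theorem proposition2p1p8:
  fixes k :: "('k, 'm) ring_scheme"
    and Z :: "('p, 'r, 'k, 'z) presheaf"
    and act :: "('p, 'r, 'k) kscheme \<Rightarrow> 'r \<Rightarrow> 'z \<Rightarrow> 'z"
  assumes "field k"
    and "k_space k Z"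
    and "Gm_action k Z act"
  shows "nat_trans k (Ztilde k Z act) (psh_prod A1 (psh_prod Z Z)) ptilde \<and>
    psh_iso k (Ztilde_over_Gm k Z act) (action_graph Z act) ptilde"
proof
  have Z: "presheaf k Z"
    using assms(2) unfolding k_space_def by (rule conjunct1)
  note act = assms(3)
  define \<beta> where "\<beta> = (\<lambda>S (t, z1 :: 'z, z2 :: 'z). (t, orbit_map k Z act S t z1))"
  show "nat_trans k (Ztilde k Z act) (psh_prod A1 (psh_prod Z Z)) ptilde"
    by (rule nat_trans_ptilde)
  have natural: "nat_trans k (Ztilde_over_Gm k Z act) (action_graph Z act) ptilde"
    unfolding nat_trans_def
  proof (intro conjI allI impI ballI)
    show "ptilde S \<in> pt (Ztilde_over_Gm k Z act) S \<rightarrow> pt (action_graph Z act) S"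
      if "kscheme k S" for S
      using ptilde_in_action_graph[OF that] by blast
    show "ptilde S (pb (Ztilde_over_Gm k Z act) S T f \<zeta>)
        = pb (action_graph Z act) S T f (ptilde T \<zeta>)"
      if "kscheme k S \<and> kscheme k T \<and> f \<in> k_hom k S T" "\<zeta> \<in> pt (Ztilde_over_Gm k Z act) T"
      for S T f \<zeta>
      unfolding pb_Ztilde_over_Gm pb_action_graph
      using that by (intro ptilde_pb) (simp_all add: Ztilde_over_Gm_def psh_sub_def)
  qed
  have natural_inverse: "nat_trans k (action_graph Z act) (Ztilde_over_Gm k Z act) \<beta>"
    unfolding nat_trans_def
  proof (intro conjI allI impI ballI)
    show "\<beta> S \<in> pt (action_graph Z act) S \<rightarrow> pt (Ztilde_over_Gm k Z act) S"
      if "kscheme k S" for S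
      using orbit_map_equivariant[OF Z act that]
      by (auto simp: \<beta>_def pt_action_graph pt_Ztilde_over_Gm)
    show "\<beta> S (pb (action_graph Z act) S T f w) = pb (Ztilde_over_Gm k Z act) S T f (\<beta> T w)"
      if "kscheme k S \<and> kscheme k T \<and> f \<in> k_hom k S T" "w \<in> pt (action_graph Z act) T"
      for S T f w
      using that orbit_map_base_change[OF Z act, of S T f]
      by (cases w) (auto simp: \<beta>_def pt_action_graph pb_action_graph_apply pb_Ztilde_over_Gm
          pb_Ztilde)
  qed
  have left: "\<beta> S (ptilde S \<zeta>) = \<zeta>"
    if "kscheme k S" "\<zeta> \<in> pt (Ztilde_over_Gm k Z act) S" for S \<zeta>
    using that equivariant_maps_eq_orbit_map[OF Z act that(1)]
    by (cases \<zeta>) (simp add: \<beta>_def ptilde_Pair pt_Ztilde_over_Gm)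
  have right: "ptilde S (\<beta> S w) = w"
    if "kscheme k S" "w \<in> pt (action_graph Z act) S" for S w
    using that ptilde_orbit_map[OF Z act that(1)] by (cases w) (simp add: \<beta>_def)
  show "psh_iso k (Ztilde_over_Gm k Z act) (action_graph Z act) ptilde"
    unfolding psh_iso_def
    using presheaf_Ztilde_over_Gm presheaf_action_graph[OF Z act] natural natural_inverse
      left right by blast
qed

end
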